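(* Let $\mathbb{k}$ be a commutative ring, $n\ge0$, and $\alpha$ a composition of $n$. Then in $\mathbb{k}S_n$, \[ \prod_{k\in\widetilde{n}_\alpha(\Sigma_n)}(w_0B_\alpha-k)=0\qquad\text{and}\qquad\prod_{k\in\widetilde{n}_\alpha(\Sigma_n)}(B_\alpha w_0-k)=0, \] where each product ranges over the distinct elements $k$ of the set $\widetilde{n}_\alpha(\Sigma_n)$ (integers being viewed as elements of $\mathbb{k}S_n$ via $k\mapsto k\cdot 1$).
   Context: $[n]=\{1,\ldots,n\}$; $S_n$ the symmetric group with $(\sigma\tau)(i)=\sigma(\tau(i))$, $\mathbb{k}S_n$ its group algebra, $w_0(i)=n+1-i$. For a composition $\alpha=(\alpha_1,\ldots,\alpha_k)$ of $n$ (positive integers with sum $n$) let $D(\alpha)=\{\alpha_1,\alpha_1+\alpha_2,\ldots,\alpha_1+\cdots+\alpha_{k-1}\}$ and $B_\alpha=\sum_{w\in S_n:\operatorname{Des}w\subseteq D(\alpha)}w$, where $\operatorname{Des}w=\{i\in[n-1]:w(i)>w(i+1)\}$. A set composition of $[n]$ is a tuple $F=(F_1,\ldots,F_m)$ of nonempty pairwise disjoint sets with union $[n]$; $\ell(F)=m$, $\operatorname{type}F=(|F_1|,\ldots,|F_m|)$; $\Sigma_n$ is the set of all of them. $F\preceq G$ means each block of $F$ lies in some block of $G$. $n_\alpha(F)=\#\{G\in\Sigma_n:F\preceq G,\ \operatorname{type}G=\alpha\}$, $\widetilde{n}_\alpha(F)=(-1)^{n-\ell(F)}n_\alpha(F)$,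 $\widetilde{n}_\alpha(\Sigma_n)=\{\widetilde{n}_\alpha(F):F\in\Sigma_n\}$. *)

theory Defs
  imports "HOL-Algebra.Sym_Groups" "HOL-Algebra.Ring"
begin

text \<open>The group algebra of a \<^emph>\<open>finite\<close> group \<open>G\<close> over a commutative ring \<open>R\<close>: an element is the
  family of its coefficients, and finiteness of \<open>G\<close> makes a support condition unnecessary.\<close>

definition group_algebra ::
  "('k, 'm) ring_scheme \<Rightarrow> ('g, 'n) monoid_scheme \<Rightarrow> ('g \<Rightarrow> 'k) ring" where
  "group_algebra R G =
    \<lparr> carrier = carrier G \<rightarrow>\<^sub>E carrier R,
      mult = (\<lambda>f g. \<lambda>x\<in>carrier G.
        (\<Oplus>\<^bsub>R\<^esub>y\<in>carrier G. f y \<otimes>\<^bsub>R\<^esub> g (inv\<^bsub>G\<^esub> y \<otimes>\<^bsub>G\<^esub> x))),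
      one = (\<lambda>x\<in>carrier G. if x = \<one>\<^bsub>G\<^esub> then \<one>\<^bsub>R\<^esub> else \<zero>\<^bsub>R\<^esub>),
      zero = (\<lambda>x\<in>carrier G. \<zero>\<^bsub>R\<^esub>),
      add = (\<lambda>f g. \<lambda>x\<in>carrier G. f x \<oplus>\<^bsub>R\<^esub> g x) \<rparr>"

definition ga_basis ::
  "('k, 'm) ring_scheme \<Rightarrow> ('g, 'n) monoid_scheme \<Rightarrow> 'g \<Rightarrow> ('g \<Rightarrow> 'k)" where
  "ga_basis R G w = (\<lambda>x\<in>carrier G. if x = w then \<one>\<^bsub>R\<^esub> else \<zero>\<^bsub>R\<^esub>)"

abbreviation sym_algebra :: "('k, 'm) ring_scheme \<Rightarrow> nat \<Rightarrow> ((nat \<Rightarrow> nat) \<Rightarrow> 'k) ring" where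
  "sym_algebra R n \<equiv> group_algebra R (sym_group n)"

definition is_composition :: "nat \<Rightarrow> nat list \<Rightarrow> bool" where
  "is_composition n \<alpha> \<longleftrightarrow> (\<forall>a\<in>set \<alpha>. 0 < a) \<and> sum_list \<alpha> = n"

definition comp_set :: "nat list \<Rightarrow> nat set" where
  "comp_set \<alpha> = {sum_list (take i \<alpha>) | i. 1 \<le> i \<and> i < length \<alpha>}"

definition descents :: "nat \<Rightarrow> (nat \<Rightarrow> nat) \<Rightarrow> nat set" where
  "descents n w = {i \<in> {1..n - 1}. w i > w (i + 1)}"

text \<open>Elements of \<^term>\<open>carrier (sym_group n)\<close> fix every number outside \<open>{1..n}\<close>.\<close>

definition longest_perm :: "nat \<Rightarrow> nat \<Rightarrow> nat" where
  "longest_perm n i = (if i \<in> {1..n} then n + 1 - i else i)"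

definition w0_elem :: "('k, 'm) ring_scheme \<Rightarrow> nat \<Rightarrow> ((nat \<Rightarrow> nat) \<Rightarrow> 'k)" where
  "w0_elem R n = ga_basis R (sym_group n) (longest_perm n)"

definition B_elem :: "('k, 'm) ring_scheme \<Rightarrow> nat \<Rightarrow> nat list \<Rightarrow> ((nat \<Rightarrow> nat) \<Rightarrow> 'k)" where
  "B_elem R n \<alpha> =
    (\<Oplus>\<^bsub>sym_algebra R n\<^esub>w\<in>{w \<in> carrier (sym_group n). descents n w \<subseteq> comp_set \<alpha>}.
      ga_basis R (sym_group n) w)"

definition set_compositions :: "nat \<Rightarrow> nat set list set" where
  "set_compositions n =
    {F. {} \<notin> set F \<and> (\<forall>i j. i < j \<and> j < length F \<longrightarrow> F ! i \<inter> F ! j = {}) \<and>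
        \<Union>(set F) = {1..n}}"

definition comp_type :: "nat set list \<Rightarrow> nat list" where
  "comp_type F = map card F"

definition block_le :: "nat set list \<Rightarrow> nat set list \<Rightarrow> bool" where
  "block_le F G \<longleftrightarrow> (\<forall>X\<in>set F. \<exists>Y\<in>set G. X \<subseteq> Y)"

definition n_count :: "nat \<Rightarrow> nat list \<Rightarrow> nat set list \<Rightarrow> nat" where
  "n_count n \<alpha> F = card {G \<in> set_compositions n. block_le F G \<and> comp_type G = \<alpha>}"

definition signed_n_count :: "nat \<Rightarrow> nat list \<Rightarrow> nat set list \<Rightarrow> int" where
  "signed_n_count n \<alpha> F = (- 1) ^ (n - length F) * int (n_count n \<alpha> F)"

text \<open>The library introduces \<^const>\<open>finprod\<close> for commutative monoids. In an arbitrary monoid it is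
  still the product in any chosen order, provided that the factors commute pairwise; this is the
  case for factors of the form \<open>x - k\<close> with \<open>x\<close> fixed and \<open>k\<close> an integer.\<close>

lemma (in monoid) finprod_commuting_factors:
  assumes "distinct ks" and "f \<in> set ks \<rightarrow> carrier G"
    and "\<And>x y. x \<in> set ks \<Longrightarrow> y \<in> set ks \<Longrightarrow> f x \<otimes> f y = f y \<otimes> f x"
  shows "finprod G f (set ks) = foldr (\<lambda>k z. f k \<otimes> z) ks \<one>"
proof -
  interpret LCD "set ks" "carrier G" "mult G \<circ> f"
  proof
    fix x y z assume "x \<in> set ks" "y \<in> set ks" "z \<in> carrier G"
    then show "(mult G \<circ> f) x ((mult G \<circ> f) y z) = (mult G \<circ> f) y ((mult G \<circ> f) x z)"
      using assms(2) assms(3)[of x y] by (auto simp: Pi_iff m_assoc[symmetric])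
  next
    fix x y assume "x \<in> set ks" "y \<in> carrier G"
    then show "(mult G \<circ> f) x y \<in> carrier G"
      using assms(2) by auto
  qed
  have "foldD (carrier G) (mult G \<circ> f) \<one> (set ls) = foldr (\<lambda>k z. f k \<otimes> z) ls \<one>"
    if "distinct ls" "set ls \<subseteq> set ks" for ls
    using that by (induction ls) (simp_all add: foldD_insert)
  then show ?thesis
    using assms(1) by (simp add: finprod_def)
qed

end

theory Submission
  imports Defs
begin

text \<open>Set compositions act on words: \<open>F\<close> lists the letters of its first block in the order in which
  they occur, then those of its second block, and so on. Writing permutations as words, right
  multiplication by \<open>B\<^sub>\<alpha>\<close> is the action of the sum of all \<open>G\<close> of type \<open>\<alpha>\<close>, and acting by \<open>F\<close> after
  right multiplication by \<open>w\<^sub>0\<close> is \<open>\<Sum> (-1)\<^bsup>n - \<ell>(H)\<^esup> H\<close>, summed over all \<open>H\<close> that subdivide the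
  blocks of \<open>F\<close>.

  Say that \<open>f\<close> has level at most \<open>K\<close> if it is killed by every \<open>F\<close> with \<open>n\<^sub>\<alpha>(F) \<ge> K\<close>; level \<open>0\<close>
  forces \<open>f = 0\<close>. Since \<open>F G\<close> is either \<open>F\<close> (when \<open>F \<preceq> G\<close>) or has a larger count, right
  multiplication by \<open>B\<^sub>\<alpha>\<close> is multiplication by \<open>K\<close> on level \<open>K + 1\<close> modulo level \<open>K\<close>. As \<open>w\<^sub>0\<close> is an
  involution preserving levels, \<open>x = w\<^sub>0 B\<^sub>\<alpha>\<close> satisfies \<open>x\<^sup>2 = K\<^sup>2\<close> there. If only one of the two signed
  counts \<open>\<pm>K\<close> occurs, then no \<open>F\<close> of count \<open>K\<close> has a proper subdivision of the same count, so
  \<open>w\<^sub>0\<close> acts there by a scalar sign, and \<open>x\<close> by the signed count that occurs. Multiplying by the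
  factors in order of decreasing \<open>|k|\<close> thus brings every element down to level \<open>0\<close>.\<close>

section \<open>Set compositions\<close>

text \<open>The ground set is arbitrary so that an induction can remove the first block
  \<open>A\<close> and continue with a set composition of \<open>X - A\<close>.\<close>

definition set_comps :: "'a set \<Rightarrow> 'a set list set" where
  "set_comps X = {F. {} \<notin> set F \<and> sorted_wrt (\<lambda>A B. A \<inter> B = {}) F \<and> \<Union>(set F) = X}"

lemma set_compositions_eq: "set_compositions n = set_comps {1..n}"
  unfolding set_compositions_def set_comps_def sorted_wrt_iff_nth_less by blast

lemma Nil_in_set_comps_iff [simp]: "[] \<in> set_comps X \<longleftrightarrow> X = {}"
  by (auto simp: set_comps_def)

lemma Cons_in_set_comps_iff:
  "A # F \<in> set_comps X \<longleftrightarrow> A \<noteq> {} \<and> A \<subseteq> X \<and> F \<in> set_comps (X - A)"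
  by (auto simp: set_comps_def)

lemma set_comps_empty [simp]: "set_comps {} = {[]}"
proof -
  have "F = []" if "F \<in> set_comps {}" for F :: "'a set list"
    using that by (cases F) (auto simp: Cons_in_set_comps_iff)
  then show ?thesis by auto
qed

lemma singleton_in_set_comps: "A \<noteq> {} \<Longrightarrow> [A] \<in> set_comps A"
  by (simp add: Cons_in_set_comps_iff)

lemma set_comps_append:
  assumes "K \<in> set_comps A" "H \<in> set_comps B" "A \<inter> B = {}"
  shows "K @ H \<in> set_comps (A \<union> B)"
proof -
  have "B1 \<inter> B2 = {}" if "B1 \<in> set K" "B2 \<in> set H" for B1 B2
    using assms that unfolding set_comps_def by blast
  then show ?thesis
    using assms by (simp add: set_comps_def sorted_wrt_append)
qed

lemma finite_set_comps:
  assumes "finite X" shows "finite (set_comps X)"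
proof (rule finite_subset)
  show "finite {F. set F \<subseteq> Pow X \<and> distinct F}"
    using assms by (intro finite_subset_distinct) simp
  have "distinct F" if "{} \<notin> set F" "sorted_wrt (\<lambda>A B. A \<inter> B = {}) F" for F :: "'a set list"
    using that by (induction F) auto
  then show "set_comps X \<subseteq> {F. set F \<subseteq> Pow X \<and> distinct F}"
    by (auto simp: set_comps_def)
qed

lemma length_set_comps_le:
  assumes "F \<in> set_comps X" "finite X" shows "length F \<le> card X"
  using assms
proof (induction F arbitrary: X)
  case (Cons A F)
  then have "length F \<le> card (X - A)" "A \<noteq> {}" "A \<subseteq> X"
    by (auto simp: Cons_in_set_comps_iff)
  moreover have "card (X - A) + card A = card X" "card A > 0"
    using \<open>finite X\<close> \<open>A \<noteq> {}\<close> \<open>A \<subseteq> X\<close>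
    by (auto simp: card_Diff_subset finite_subset card_mono card_gt_0_iff)
  ultimately show ?case by simp
qed simp

text \<open>No set composition of \<open>A\<close> is a proper prefix of another one, because its
  blocks already exhaust \<open>A\<close>. Hence the point where the concatenation splits is
  determined.\<close>

lemma set_comps_append_cancel:
  assumes "K \<in> set_comps A" "K' \<in> set_comps A" "K @ H = K' @ H'"
  shows "K = K'"
  using assms
proof (induction K arbitrary: A K')
  case (Cons B K)
  then show ?case by (cases K') (auto simp: Cons_in_set_comps_iff)
qed simp

section \<open>Subdivisions of the blocks of a set composition\<close>

text \<open>In the braid arrangement these are the faces that have \<open>F\<close> as a face. The
  pieces of a block stay at the place of that block, so membership is stronger than
  \<open>block_le\<close>.\<close>

fun refinements :: "'a set list \<Rightarrow> 'a set list set" where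
  "refinements [] = {[]}"
| "refinements (A # F) = (\<lambda>(K, H). K @ H) ` (set_comps A \<times> refinements F)"

text \<open>Turns a sum over \<open>refinements (A # F)\<close> into a double sum.\<close>

lemma inj_on_append_set_comps: "inj_on (\<lambda>(K, H). K @ H) (set_comps A \<times> S)"
proof (rule inj_onI, clarify)
  fix K H K' H' assume "K \<in> set_comps A" "K' \<in> set_comps A" "K @ H = K' @ H'"
  moreover from this have "K = K'" by (rule set_comps_append_cancel)
  ultimately show "K = K' \<and> H = H'" by simp
qed

lemma refinements_in_set_comps:
  assumes "F \<in> set_comps X" "H \<in> refinements F" shows "H \<in> set_comps X"
  using assms
proof (induction F arbitrary: X H)
  case (Cons A F)
  then obtain K H' where "H = K @ H'" "K \<in> set_comps A" "H' \<in> refinements F"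
    by auto
  moreover have "A \<subseteq> X" "H' \<in> set_comps (X - A)"
    using Cons \<open>H' \<in> _\<close> by (auto simp: Cons_in_set_comps_iff)
  ultimately show ?case
    using set_comps_append[of K A H' "X - A"] by (simp add: Un_absorb1)
qed simp

lemma self_in_refinements: "{} \<notin> set F \<Longrightarrow> F \<in> refinements F"
proof (induction F)
  case (Cons A F)
  then show ?case
    by (auto intro!: image_eqI[of _ _ "([A], F)"] singleton_in_set_comps)
qed simp

lemma finite_refinements:
  "(\<And>A. A \<in> set F \<Longrightarrow> finite A) \<Longrightarrow> finite (refinements F)"
  by (induction F) (auto intro!: finite_imageI finite_cartesian_product finite_set_comps)

lemma block_le_refl: "block_le F F"
  by (auto simp: block_le_def)

lemma block_le_trans: "block_le F G \<Longrightarrow> block_le G H \<Longrightarrow> block_le F H"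
  unfolding block_le_def by (meson subset_trans)

lemma block_le_append:
  "block_le (F @ F') G \<longleftrightarrow> block_le F G \<and> block_le F' G"
  by (auto simp: block_le_def)

lemma block_le_if_in_set_comps: "K \<in> set_comps A \<Longrightarrow> A \<in> set G \<Longrightarrow> block_le K G"
  by (auto simp: block_le_def set_comps_def)

lemma block_le_Cons: "block_le (A # F) G \<longleftrightarrow> (\<exists>Y\<in>set G. A \<subseteq> Y) \<and> block_le F G"
  by (simp add: block_le_def)

lemma block_le_Cons_right: "block_le F G \<Longrightarrow> block_le F (A # G)"
  by (auto simp: block_le_def)

lemma block_le_refinements: "H \<in> refinements F \<Longrightarrow> block_le H F"
proof (induction F arbitrary: H)
  case (Cons A F)
  then obtain K H' where "H = K @ H'" "K \<in> set_comps A" "block_le H' F"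
    by auto
  moreover from this have "block_le K (A # F)" "block_le H' (A # F)"
    by (simp_all add: block_le_if_in_set_comps block_le_Cons_right)
  ultimately show ?case
    by (simp add: block_le_append)
qed (simp add: block_le_def)

text \<open>It suffices to cut a single block of \<open>F\<close> into two. If the subdivision
  changes only the first block \<open>A\<close>, the cut separates its first piece \<open>B\<close>
  from \<open>A - B\<close>; otherwise the cut is found among the later blocks.\<close>

lemma refinements_intermediate:
  assumes "H \<in> refinements F" "H \<noteq> F" "{} \<notin> set F"
  shows "\<exists>F'\<in>refinements F. block_le H F' \<and> length F' = Suc (length F)"
  using assms
proof (induction F arbitrary: H)
  case (Cons A F)
  then obtain K H' where H: "H = K @ H'" "K \<in> set_comps A" "H' \<in> refinements F"
    by auto
  show ?case
  proof (cases "H' = F")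
    case True
    moreover have "K \<noteq> []" using H Cons.prems by auto
    ultimately obtain B K' where K: "K = B # K'" "B \<noteq> {}" "B \<subseteq> A" "K' \<in> set_comps (A - B)"
      using H by (cases K) (auto simp: Cons_in_set_comps_iff)
    have "A - B \<noteq> {}"
    proof
      assume "A - B = {}"
      then have "K = [A]" using K by auto
      then show False using True H Cons.prems by simp
    qed
    then have "[B, A - B] \<in> set_comps A"
      using K by (auto simp: Cons_in_set_comps_iff)
    moreover have "F \<in> refinements F"
      using Cons.prems by (auto intro: self_in_refinements)
    ultimately have "[B, A - B] @ F \<in> refinements (A # F)"
      by (auto simp del: append.simps)
    moreover have "block_le H ([B, A - B] @ F)"
      using K H True
      by (simp add: block_le_append block_le_Cons block_le_if_in_set_comps block_le_Cons_right
          block_le_refl)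
    ultimately show ?thesis by (intro bexI conjI) simp_all
  next
    case False
    then obtain F' where F': "F' \<in> refinements F" "block_le H' F'" "length F' = Suc (length F)"
      using Cons H by auto
    have "[A] \<in> set_comps A"
      using Cons.prems by (auto intro: singleton_in_set_comps)
    with F'(1) have "[A] @ F' \<in> refinements (A # F)"
      by (auto simp del: append.simps)
    moreover have "block_le H ([A] @ F')"
      using H F' by (simp add: block_le_append block_le_if_in_set_comps block_le_Cons_right)
    ultimately show ?thesis using F' by (intro bexI conjI) simp_all
  qed
qed simp

section \<open>The product of set compositions and its action on words\<close>

text \<open>The Tits product of faces of the braid arrangement.\<close>

definition face_prod :: "'a set list \<Rightarrow> 'a set list \<Rightarrow> 'a set list" where
  "face_prod F G = concat (map (\<lambda>A. filter (\<lambda>B. B \<noteq> {}) (map ((\<inter>) A) G)) F)"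

text \<open>An inclusion \<open>X \<subseteq> Y\<close> instead of an equality lets the induction
  shrink \<open>X\<close> to \<open>X - A\<close> while \<open>G\<close> stays fixed.\<close>

lemma face_prod_in_set_comps:
  assumes "F \<in> set_comps X" "G \<in> set_comps Y" "X \<subseteq> Y"
  shows "face_prod F G \<in> set_comps X"
  using assms
proof (induction F arbitrary: X)
  case (Cons A F)
  have G: "sorted_wrt (\<lambda>B B'. B \<inter> B' = {}) G" "\<Union>(set G) = Y"
    using Cons.prems by (simp_all add: set_comps_def)
  have A: "A \<subseteq> X" "F \<in> set_comps (X - A)"
    using Cons.prems by (simp_all add: Cons_in_set_comps_iff)
  have "sorted_wrt (\<lambda>B B'. (A \<inter> B) \<inter> (A \<inter> B') = {}) G"
    by (rule sorted_wrt_mono_rel[OF _ G(1)]) blast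
  then have "sorted_wrt (\<lambda>B B'. B \<inter> B' = {}) (filter (\<lambda>B. B \<noteq> {}) (map ((\<inter>) A) G))"
    by (intro sorted_wrt_filter) (simp add: sorted_wrt_map)
  moreover have "\<Union>(set (filter (\<lambda>B. B \<noteq> {}) (map ((\<inter>) A) G))) = A \<inter> \<Union>(set G)"
    by auto
  moreover have "A \<subseteq> \<Union>(set G)"
    using G A Cons.prems by simp
  ultimately have "filter (\<lambda>B. B \<noteq> {}) (map ((\<inter>) A) G) \<in> set_comps A"
    by (simp add: set_comps_def Int_absorb2)
  moreover have "face_prod F G \<in> set_comps (X - A)"
    using A Cons.prems by (intro Cons.IH) auto
  moreover have "A \<union> (X - A) = X"
    using A by auto
  ultimately show ?case
    using set_comps_append[of _ A "face_prod F G" "X - A"] by (simp add: face_prod_def)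
qed (simp add: face_prod_def)

lemma block_le_face_prod_left: "block_le (face_prod F G) F"
  and block_le_face_prod_right: "block_le (face_prod F G) G"
  by (auto simp: block_le_def face_prod_def)

text \<open>The left multiplication of chambers by faces in the braid arrangement.\<close>

definition act :: "'a set list \<Rightarrow> 'a list \<Rightarrow> 'a list" where
  "act F xs = concat (map (\<lambda>A. filter (\<lambda>x. x \<in> A) xs) F)"

lemma act_Nil [simp]: "act [] xs = []"
  and act_Cons [simp]: "act (A # F) xs = filter (\<lambda>x. x \<in> A) xs @ act F xs"
  and act_append [simp]: "act (F @ G) xs = act F xs @ act G xs"
  by (simp_all add: act_def)

lemma act_filter_nonempty: "act (filter (\<lambda>B. B \<noteq> {}) F) xs = act F xs"
  by (induction F) auto

lemma filter_act: "filter (\<lambda>x. x \<in> A) (act G xs) = act (map ((\<inter>) A) G) xs"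
  by (induction G) (simp_all add: conj_commute)

text \<open>A block \<open>A\<close> of \<open>F\<close> picks its letters out of
  \<open>act G xs\<close> in the order of the blocks of \<open>G\<close>, and empty intersections
  contribute no letters. So \<open>act\<close> is an action of the Tits product.\<close>

lemma act_face_prod: "act (face_prod F G) xs = act F (act G xs)"
  by (induction F) (simp_all add: face_prod_def act_filter_nonempty filter_act)

text \<open>All letters of \<open>A\<close> sit in the segment of \<open>act G xs\<close> that
  belongs to \<open>Y\<close>, and within this segment the order of \<open>xs\<close> is
  kept.\<close>

lemma filter_act_block:
  assumes "G \<in> set_comps X" "Y \<in> set G" "A \<subseteq> Y"
  shows "filter (\<lambda>x. x \<in> A) (act G xs) = filter (\<lambda>x. x \<in> A) xs"
  using assms
proof (induction G arbitrary: X)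
  case (Cons B G)
  have *: "\<And>B'. B' \<in> set G \<Longrightarrow> B \<inter> B' = {}"
    using Cons.prems by (auto simp: set_comps_def)
  show ?case
  proof (cases "Y = B")
    case True
    then have "B' \<inter> A = {}" if "B' \<in> set G" for B'
      using * Cons.prems that by blast
    then have "act (map ((\<inter>) A) G) xs = []"
      by (force simp: act_def filter_empty_conv)
    moreover have "filter (\<lambda>x. x \<in> A) (filter (\<lambda>x. x \<in> B) xs) = filter (\<lambda>x. x \<in> A) xs"
      using True \<open>A \<subseteq> Y\<close> by (auto intro: filter_cong)
    ultimately show ?thesis
      by (simp add: filter_act del: filter_filter)
  next
    case False
    then have "Y \<in> set G" using Cons.prems by simp
    then have "A \<inter> B = {}" using * Cons.prems by blast
    then have "filter (\<lambda>x. x \<in> A) (filter (\<lambda>x. x \<in> B) xs) = []"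
      by (auto simp: filter_empty_conv)
    moreover have "G \<in> set_comps (X - B)"
      using Cons.prems by (simp add: Cons_in_set_comps_iff)
    ultimately show ?thesis
      using Cons.IH \<open>Y \<in> set G\<close> \<open>A \<subseteq> Y\<close> by (simp del: filter_filter)
  qed
qed simp

lemma act_act_of_block_le:
  assumes "G \<in> set_comps X" "block_le F G"
  shows "act F (act G xs) = act F xs"
  using assms(2)
proof (induction F)
  case (Cons A F)
  then show ?case
    using filter_act_block[OF assms(1)] by (auto simp: block_le_Cons)
qed simp

lemma act_cong_filter:
  assumes "\<And>B. B \<in> set F \<Longrightarrow> B \<subseteq> A"
  shows "act F (filter (\<lambda>x. x \<in> A) xs) = act F xs"
  using assms
proof (induction F)
  case (Cons B F)
  then have "filter (\<lambda>x. x \<in> A \<and> x \<in> B) xs = filter (\<lambda>x. x \<in> B) xs"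
    by (intro filter_cong) auto
  then show ?case using Cons by simp
qed simp

text \<open>Equivariance under relabelling of letters; it carries statements about the identity word
  over to the word of any permutation.\<close>

lemma act_map_image:
  assumes "inj f" shows "act (map ((`) f) F) (map f xs) = map f (act F xs)"
  using assms by (induction F) (simp_all add: filter_map o_def inj_image_mem_iff)

text \<open>The antipode identity: the subsets with and without the last letter cancel in pairs.\<close>

lemma sum_Pow_filter_rev:
  fixes g :: "'a list \<Rightarrow> int"
  assumes "distinct xs" "xs \<noteq> []"
  shows "(\<Sum>A\<in>Pow (set xs). (- 1) ^ card A *
           g (filter (\<lambda>x. x \<in> A) xs @ rev (filter (\<lambda>x. x \<notin> A) xs))) = 0"
proof -
  obtain ys z where xs: "xs = ys @ [z]"
    using \<open>xs \<noteq> []\<close> by (metis append_butlast_last_id)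
  then have z: "z \<notin> set ys" using assms by auto
  define h where "h A = (- 1) ^ card A *
           g (filter (\<lambda>x. x \<in> A) xs @ rev (filter (\<lambda>x. x \<notin> A) xs))" for A
  \<comment> \<open>The letter \<open>z\<close> either ends the first segment or begins the reversed
    second one. This is the same place in the same word, so only the sign changes.\<close>
  have h: "h (insert z A) = - h A" if "A \<in> Pow (set ys)" for A
  proof -
    have "finite A" "z \<notin> A" using that z by (auto intro: finite_subset)
    moreover have "filter (\<lambda>x. x \<in> insert z A) ys = filter (\<lambda>x. x \<in> A) ys"
      "filter (\<lambda>x. x \<notin> insert z A) ys = filter (\<lambda>x. x \<notin> A) ys"
      using z by (auto intro!: filter_cong)
    ultimately show ?thesis
      unfolding h_def xs by simp
  qed
  have "Pow (set xs) = Pow (set ys) \<union> insert z ` Pow (set ys)"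
    unfolding xs by (simp add: Pow_insert)
  moreover have "Pow (set ys) \<inter> insert z ` Pow (set ys) = {}"
    using z by auto
  moreover have "inj_on (insert z) (Pow (set ys))"
    using z by (auto simp: inj_on_def)
  ultimately have "sum h (Pow (set xs)) = sum h (Pow (set ys)) + (\<Sum>A\<in>Pow (set ys). h (insert z A))"
    by (simp add: sum.union_disjoint sum.reindex)
  then show ?thesis
    using h by (simp add: h_def sum_negf)
qed

lemma sum_set_comps_Cons:
  assumes "finite A" "A \<noteq> {}"
  shows "(\<Sum>K\<in>set_comps A. h K) = (\<Sum>B\<in>Pow A - {{}}. \<Sum>K\<in>set_comps (A - B). h (B # K))"
proof -
  have "set_comps A = (\<lambda>(B, K). B # K) ` (SIGMA B:Pow A - {{}}. set_comps (A - B))"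
  proof (intro Set.set_eqI iffI)
    fix K assume "K \<in> set_comps A"
    then show "K \<in> (\<lambda>(B, K). B # K) ` (SIGMA B:Pow A - {{}}. set_comps (A - B))"
      using assms by (cases K) (auto simp: Cons_in_set_comps_iff)
  qed (auto simp: Cons_in_set_comps_iff)
  then have "(\<Sum>K\<in>set_comps A. h K) =
      (\<Sum>(B, K)\<in>(SIGMA B:Pow A - {{}}. set_comps (A - B)). h (B # K))"
    by (simp add: sum.reindex inj_on_def case_prod_unfold)
  also have "\<dots> = (\<Sum>B\<in>Pow A - {{}}. \<Sum>K\<in>set_comps (A - B). h (B # K))"
    using assms by (intro sum.Sigma[symmetric]) (auto intro: finite_set_comps)
  finally show ?thesis .
qed

text \<open>This has the shape of Takeuchi's formula for an antipode. Splitting off the first block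
  \<open>B\<close> and applying induction to the remaining letters leaves an alternating sum over
  nonempty \<open>B\<close>, which is evaluated by \<open>sum_Pow_filter_rev\<close>.\<close>

lemma sum_set_comps_act:
  fixes g :: "'a list \<Rightarrow> int"
  assumes "distinct xs"
  shows "(\<Sum>K\<in>set_comps (set xs). (- 1) ^ length K * g (act K xs)) = (- 1) ^ length xs * g (rev xs)"
  using assms
proof (induction "length xs" arbitrary: xs g rule: less_induct)
  case less
  show ?case
  proof (cases "xs = []")
    case False
    then have ne: "set xs \<noteq> {}" by simp
    have inner: "(\<Sum>K\<in>set_comps (set xs - B). (- 1) ^ length (B # K) * g (act (B # K) xs)) =
        - ((- 1) ^ length xs * ((- 1) ^ card B *
          g (filter (\<lambda>x. x \<in> B) xs @ rev (filter (\<lambda>x. x \<notin> B) xs))))"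
      if B: "B \<in> Pow (set xs) - {{}}" for B
    proof -
      let ?ys = "filter (\<lambda>x. x \<notin> B) xs"
      have len: "length xs = card B + length ?ys"
      proof -
        have "length (filter (\<lambda>x. x \<in> B) xs) = card B"
          using B less.prems by (subst distinct_card[symmetric]) (auto intro: arg_cong[of _ _ card])
        then show ?thesis
          using sum_length_filter_compl[of "\<lambda>x. x \<in> B" xs] by simp
      qed
      have "card B > 0" using B by (auto simp: card_gt_0_iff intro: finite_subset)
      have ys: "set ?ys = set xs - B" by auto
      have act: "act K xs = act K ?ys" if "K \<in> set_comps (set xs - B)" for K
      proof -
        have "act K (filter (\<lambda>x. x \<in> set xs - B) xs) = act K xs"
          using that by (intro act_cong_filter) (auto simp: set_comps_def)
        moreover have "filter (\<lambda>x. x \<in> set xs - B) xs = ?ys"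
          by (auto intro: filter_cong)
        ultimately show ?thesis by simp
      qed
      have "(\<Sum>K\<in>set_comps (set xs - B). (- 1) ^ length (B # K) * g (act (B # K) xs)) =
          - (\<Sum>K\<in>set_comps (set ?ys). (- 1) ^ length K * g (filter (\<lambda>x. x \<in> B) xs @ act K ?ys))"
        unfolding ys by (simp add: act sum_negf[symmetric])
      \<comment> \<open>The induction hypothesis holds for every function on words; here it is
        applied to \<open>g\<close> with the letters of the first block prefixed.\<close>
      also have "\<dots> = - ((- 1) ^ length ?ys * g (filter (\<lambda>x. x \<in> B) xs @ rev ?ys))"
        using len \<open>card B > 0\<close> less.prems
        by (subst less.hyps[of ?ys "\<lambda>zs. g (filter (\<lambda>x. x \<in> B) xs @ zs)"]) auto
      also have "(- 1 :: int) ^ length ?ys = (- 1) ^ length xs * (- 1) ^ card B"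
        unfolding len by (simp add: power_add)
      finally show ?thesis by simp
    qed
    have "(\<Sum>K\<in>set_comps (set xs). (- 1) ^ length K * g (act K xs)) =
        (\<Sum>B\<in>Pow (set xs) - {{}}. - ((- 1) ^ length xs * ((- 1) ^ card B *
          g (filter (\<lambda>x. x \<in> B) xs @ rev (filter (\<lambda>x. x \<notin> B) xs)))))"
      by (subst sum_set_comps_Cons[OF finite_set ne]) (rule sum.cong[OF refl inner])
    also have "\<dots> = - ((- 1) ^ length xs * (\<Sum>B\<in>Pow (set xs) - {{}}. (- 1) ^ card B *
          g (filter (\<lambda>x. x \<in> B) xs @ rev (filter (\<lambda>x. x \<notin> B) xs))))"
      by (simp add: sum_negf sum_distrib_left)
    \<comment> \<open>The sum over all subsets vanishes, and its term for the empty set is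
      \<open>g (rev xs)\<close>.\<close>
    also have "(\<Sum>B\<in>Pow (set xs) - {{}}. (- 1) ^ card B *
          g (filter (\<lambda>x. x \<in> B) xs @ rev (filter (\<lambda>x. x \<notin> B) xs))) = - g (rev xs)"
      using sum_Pow_filter_rev[OF less.prems False, of g] by (simp add: sum_diff1)
    finally show ?thesis by simp
  qed simp
qed

text \<open>The identity for a single block is applied to each block of \<open>F\<close> in turn,
  and the signs multiply to \<open>(- 1) ^ card X\<close>. The word may have letters outside
  \<open>X\<close>, since the induction removes blocks but keeps the word.\<close>

lemma sum_refinements_act:
  fixes g :: "'a list \<Rightarrow> int"
  assumes "F \<in> set_comps X" "X \<subseteq> set xs" "distinct xs"
  shows "(\<Sum>H\<in>refinements F. (- 1) ^ length H * g (act H xs)) =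
    (- 1) ^ card X * g (act F (rev xs))"
  using assms(1,2)
proof (induction F arbitrary: X g)
  case (Cons A F)
  let ?ys = "filter (\<lambda>x. x \<in> A) xs"
  have A: "A \<subseteq> X" "F \<in> set_comps (X - A)" using Cons.prems by (auto simp: Cons_in_set_comps_iff)
  have ys: "set ?ys = A" "distinct ?ys" using A Cons.prems assms by auto
  have fin: "finite X" using Cons.prems finite_subset by blast
  have act: "act K xs = act K ?ys" if "K \<in> set_comps A" for K
    using that by (intro act_cong_filter[symmetric]) (auto simp: set_comps_def)
  have "(\<Sum>H\<in>refinements (A # F). (- 1) ^ length H * g (act H xs)) =
      (\<Sum>(K, H)\<in>set_comps A \<times> refinements F. (- 1) ^ length (K @ H) * g (act (K @ H) xs))"
    by (simp only: refinements.simps sum.reindex[OF inj_on_append_set_comps])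
      (auto intro!: sum.cong)
  also have "\<dots> = (\<Sum>K\<in>set_comps A. (- 1) ^ length K *
      (\<Sum>H\<in>refinements F. (- 1) ^ length H * g (act K xs @ act H xs)))"
    by (simp add: sum.cartesian_product[symmetric] power_add sum_distrib_left mult.assoc)
  also have "\<dots> = (\<Sum>K\<in>set_comps A. (- 1) ^ length K *
      ((- 1) ^ card (X - A) * g (act K xs @ act F (rev xs))))"
    using Cons.prems
    by (subst Cons.IH[OF A(2), where g = "\<lambda>zs. g (act K xs @ zs)" for K]) auto
  also have "\<dots> = (- 1) ^ card (X - A) *
      (\<Sum>K\<in>set_comps (set ?ys). (- 1) ^ length K * g (act K ?ys @ act F (rev xs)))"
    unfolding ys by (auto simp: act sum_distrib_left intro!: sum.cong)
  also have "\<dots> = (- 1) ^ card (X - A) * ((- 1) ^ length ?ys * g (rev ?ys @ act F (rev xs)))"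
    by (subst sum_set_comps_act[OF ys(2), of "\<lambda>zs. g (zs @ act F (rev xs))"]) simp
  also have "length ?ys = card A"
    using ys distinct_card by metis
  finally have "(\<Sum>H\<in>refinements (A # F). (- 1) ^ length H * g (act H xs)) =
      (- 1) ^ card (X - A) * ((- 1) ^ card A * g (rev ?ys @ act F (rev xs)))" .
  moreover have "(- 1 :: int) ^ card X = (- 1) ^ card (X - A) * (- 1) ^ card A"
    using A fin by (simp add: power_add[symmetric] card_Diff_subset finite_subset card_mono)
  ultimately show ?case
    by (simp add: rev_filter)
qed simp

section \<open>Words of permutations and descents\<close>

definition word :: "nat \<Rightarrow> (nat \<Rightarrow> nat) \<Rightarrow> nat list" where
  "word n w = map w [1..<Suc n]"

lemma word_comp: "word n (u \<circ> v) = map u (word n v)"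
  by (simp add: word_def)

lemma length_word: "length (word n w) = n"
  by (simp add: word_def)

lemma nth_word: "i < n \<Longrightarrow> word n w ! i = w (Suc i)"
  by (simp add: word_def del: upt_Suc)

lemma word_longest_perm: "word n (w \<circ> longest_perm n) = rev (word n w)"
  by (rule nth_equalityI)
    (auto simp: length_word rev_nth nth_word longest_perm_def Suc_diff_Suc intro: arg_cong[of _ _ w])

lemma set_word: "w permutes {1..n} \<Longrightarrow> set (word n w) = {1..n}"
  by (simp add: word_def atLeastLessThanSuc_atLeastAtMost permutes_image del: upt_Suc)

lemma distinct_word: "w permutes {1..n} \<Longrightarrow> distinct (word n w)"
  by (simp add: word_def distinct_map permutes_inj_on del: upt_Suc)

lemma inj_on_word: "inj_on (word n) {w. w permutes {1..n}}"
proof (rule inj_onI, rule ext)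
  fix u v i assume uv: "u \<in> {w. w permutes {1..n}}" "v \<in> {w. w permutes {1..n}}" "word n u = word n v"
  show "u i = v i"
  proof (cases "i \<in> {1..n}")
    case True
    then show ?thesis
      using uv(3) nth_word[of "i - 1" n u] nth_word[of "i - 1" n v] by auto
  next
    case False
    then show ?thesis using uv permutes_not_in by (metis mem_Collect_eq)
  qed
qed

lemma ex_word_eq:
  assumes "distinct xs" "set xs = {1..n}"
  obtains w where "w permutes {1..n}" "word n w = xs"
proof -
  define w where "w i = (if i \<in> {1..n} then xs ! (i - 1) else i)" for i
  have len: "length xs = n"
    using assms distinct_card by fastforce
  have word: "word n w = xs"
    by (rule nth_equalityI) (auto simp: len length_word nth_word w_def)
  have "bij_betw w {1..n} {1..n}"
    using assms unfolding word[symmetric]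
    by (simp add: bij_betw_def word_def distinct_map atLeastLessThanSuc_atLeastAtMost del: upt_Suc)
  then have "w permutes {1..n}"
    by (rule bij_imp_permutes) (auto simp: w_def)
  with word show ?thesis by (rule that[rotated])
qed

section \<open>The descent condition as monotonicity on consecutive segments\<close>

text \<open>A recursive form of the descent condition: recursion along the parts of \<alpha> matches
  the way \<open>act\<close> builds a word block by block.\<close>

fun chunks_sorted :: "nat list \<Rightarrow> 'a::linorder list \<Rightarrow> bool" where
  "chunks_sorted [] xs \<longleftrightarrow> True"
| "chunks_sorted (a # \<alpha>) xs \<longleftrightarrow> sorted (take a xs) \<and> chunks_sorted \<alpha> (drop a xs)"

lemma comp_set_Cons:
  "comp_set (a # \<alpha>) = (if \<alpha> = [] then {} else insert a ((+) a ` comp_set \<alpha>))"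
proof (cases "\<alpha> = []")
  case False
  have eq: "comp_set \<beta> = (\<lambda>i. sum_list (take i \<beta>)) ` {1..<length \<beta>}" for \<beta>
    by (auto simp: comp_set_def)
  have "{1..<length (a # \<alpha>)} = insert 1 (Suc ` {1..<length \<alpha>})"
    using False by (auto simp: Suc_le_eq)
  then show ?thesis
    unfolding eq using False by (simp only: image_insert image_image) simp
qed (simp add: comp_set_def)

text \<open>List positions start at 0 while descents are counted from 1, so a drop between positions
  \<open>i\<close> and \<open>Suc i\<close> is a descent at \<open>Suc i\<close>.\<close>

lemma chunks_sorted_iff:
  assumes "length xs = sum_list \<alpha>"
  shows "chunks_sorted \<alpha> xs \<longleftrightarrow>
    (\<forall>i. Suc i < length xs \<and> xs ! i > xs ! Suc i \<longrightarrow> Suc i \<in> comp_set \<alpha>)"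
  using assms
proof (induction \<alpha> arbitrary: xs)
  case (Cons a \<alpha>)
  have len: "length xs = a + sum_list \<alpha>" and IH: "chunks_sorted \<alpha> (drop a xs) \<longleftrightarrow>
      (\<forall>i. Suc i < sum_list \<alpha> \<and> xs ! (a + i) > xs ! Suc (a + i) \<longrightarrow> Suc i \<in> comp_set \<alpha>)"
    using Cons.prems Cons.IH[of "drop a xs"] by auto
  have srt: "sorted (take a xs) \<longleftrightarrow> (\<forall>i. Suc i < a \<longrightarrow> xs ! i \<le> xs ! Suc i)"
    using len by (auto simp: sorted_iff_nth_Suc)
  \<comment> \<open>No element of \<open>comp_set (a # \<alpha>)\<close> is below \<open>a\<close>,
    so no descent is allowed inside the first segment.\<close>
  have ge: "a \<le> x" if "x \<in> comp_set (a # \<alpha>)" for x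
    using that by (auto simp: comp_set_Cons split: if_splits)
  show ?case
  proof
    assume L: "chunks_sorted (a # \<alpha>) xs"
    show "\<forall>i. Suc i < length xs \<and> xs ! i > xs ! Suc i \<longrightarrow> Suc i \<in> comp_set (a # \<alpha>)"
    proof (intro allI impI, elim conjE)
      fix i assume i: "Suc i < length xs" "xs ! i > xs ! Suc i"
      have "\<not> Suc i < a" using i L srt by force
      moreover have "\<alpha> \<noteq> []" using i len \<open>\<not> Suc i < a\<close> by auto
      moreover have "Suc (i - a) \<in> comp_set \<alpha>" if "a \<le> i"
        using that L IH[THEN iffD1, rule_format, of "i - a"] i len by auto
      ultimately show "Suc i \<in> comp_set (a # \<alpha>)"
        by (cases "Suc i = a") (auto simp: comp_set_Cons intro!: image_eqI[of _ _ "Suc (i - a)"])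
    qed
  next
    assume R: "\<forall>i. Suc i < length xs \<and> xs ! i > xs ! Suc i \<longrightarrow> Suc i \<in> comp_set (a # \<alpha>)"
    have "xs ! i \<le> xs ! Suc i" if "Suc i < a" for i
      using R[rule_format, of i] ge[of "Suc i"] that len by force
    moreover have "Suc i \<in> comp_set \<alpha>"
      if "Suc i < sum_list \<alpha>" "xs ! (a + i) > xs ! Suc (a + i)" for i
      using R[rule_format, of "a + i"] that len by (auto simp: comp_set_Cons split: if_splits)
    ultimately show "chunks_sorted (a # \<alpha>) xs"
      using srt IH by simp
  qed
qed simp

lemma descents_subset_comp_set_iff:
  assumes "sum_list \<alpha> = n"
  shows "descents n w \<subseteq> comp_set \<alpha> \<longleftrightarrow> chunks_sorted \<alpha> (word n w)"
proof -
  have "descents n w \<subseteq> comp_set \<alpha> \<longleftrightarrow>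
      (\<forall>i. Suc i < n \<and> w (Suc i) > w (Suc (Suc i)) \<longrightarrow> Suc i \<in> comp_set \<alpha>)"
  proof
    assume R: "\<forall>i. Suc i < n \<and> w (Suc i) > w (Suc (Suc i)) \<longrightarrow> Suc i \<in> comp_set \<alpha>"
    show "descents n w \<subseteq> comp_set \<alpha>"
    proof
      fix j assume "j \<in> descents n w"
      then show "j \<in> comp_set \<alpha>"
        using R by (cases j) (auto simp: descents_def)
    qed
  qed (auto simp: descents_def)
  then show ?thesis
    using assms by (simp add: chunks_sorted_iff length_word nth_word cong: conj_cong)
qed

section \<open>Words of permutations from set compositions of type \<alpha>\<close>

lemma set_act: "F \<in> set_comps X \<Longrightarrow> X \<subseteq> set xs \<Longrightarrow> set (act F xs) = X"
proof (induction F arbitrary: X)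
  case (Cons A F)
  then have "A \<subseteq> X" "set (act F xs) = X - A" by (auto simp: Cons_in_set_comps_iff)
  then show ?case using Cons.prems by auto
qed simp

lemma distinct_act:
  "F \<in> set_comps X \<Longrightarrow> X \<subseteq> set xs \<Longrightarrow> distinct xs \<Longrightarrow> distinct (act F xs)"
proof (induction F arbitrary: X)
  case (Cons A F)
  then have F: "F \<in> set_comps (X - A)" "X - A \<subseteq> set xs" by (auto simp: Cons_in_set_comps_iff)
  then have "set (act F xs) = X - A" by (rule set_act)
  then show ?case using Cons.IH[OF F] Cons.prems by auto
qed simp

lemma length_filter_card:
  "distinct xs \<Longrightarrow> A \<subseteq> set xs \<Longrightarrow> length (filter (\<lambda>x. x \<in> A) xs) = card A"
  by (subst distinct_card[symmetric]) (auto intro: arg_cong[of _ _ card])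

text \<open>The prescribed block sizes tell where to cut the word, and the letters of each segment
  form the corresponding block.\<close>

lemma inj_on_act:
  assumes "distinct xs"
  shows "inj_on (\<lambda>F. act F xs) {F \<in> set_comps (set xs). map card F = \<alpha>}"
proof (rule inj_onI)
  have eq: "F = G" if "map card F = map card G" "act F xs = act G xs"
    "\<forall>A\<in>set F \<union> set G. A \<subseteq> set xs" for F G
    using that
  proof (induction F arbitrary: G)
    case (Cons A F)
    then obtain B G' where G: "G = B # G'" by (cases G) auto
    have "filter (\<lambda>x. x \<in> A) xs = filter (\<lambda>x. x \<in> B) xs \<and> act F xs = act G' xs"
      using Cons.prems assms G by (simp add: length_filter_card)
    moreover from this have "A \<inter> set xs = B \<inter> set xs"
      by (metis (no_types) Int_commute set_filter Collect_conj_eq Collect_mem_eq)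
    ultimately show ?case using Cons G by (auto simp: Int_absorb2)
  qed simp
  fix F G assume FG: "F \<in> {F \<in> set_comps (set xs). map card F = \<alpha>}"
    "G \<in> {F \<in> set_comps (set xs). map card F = \<alpha>}" "act F xs = act G xs"
  then have "\<Union>(set F) = set xs" "\<Union>(set G) = set xs"
    by (simp_all add: set_comps_def)
  then have "\<forall>A\<in>set F \<union> set G. A \<subseteq> set xs" by blast
  with FG show "F = G" by (intro eq) simp_all
qed

lemma chunks_sorted_act:
  fixes xs :: "'a::linorder list"
  assumes "sorted xs" "distinct xs" "\<forall>A\<in>set F. A \<subseteq> set xs"
  shows "chunks_sorted (map card F) (act F xs)"
  using assms(3)
  by (induction F) (use assms in \<open>auto simp: length_filter_card sorted_filter[of id, simplified]\<close>)

lemma ex_act_eq: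
  fixes xs ys :: "'a::linorder list"
  assumes "sorted xs" "distinct xs" "set ys \<subseteq> set xs" "distinct ys"
    "\<forall>a\<in>set \<alpha>. 0 < a" "length ys = sum_list \<alpha>" "chunks_sorted \<alpha> ys"
  shows "\<exists>F\<in>set_comps (set ys). map card F = \<alpha> \<and> act F xs = ys"
  using assms(3-)
proof (induction \<alpha> arbitrary: ys)
  case (Cons a \<alpha>)
  define A where "A = set (take a ys)"
  have "set ys = A \<union> set (drop a ys)"
    unfolding A_def by (metis append_take_drop_id set_append)
  moreover have "A \<inter> set (drop a ys) = {}"
    unfolding A_def using Cons.prems by (intro set_take_disj_set_drop_if_distinct) auto
  ultimately have disj: "set (drop a ys) = set ys - A" "A \<subseteq> set ys"
    by auto
  have "card A = a"
    using Cons.prems by (simp add: A_def distinct_card)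
  \<comment> \<open>Both lists are sorted and repetition-free with the same elements, hence
    equal.\<close>
  moreover have "filter (\<lambda>x. x \<in> A) xs = take a ys"
    using Cons.prems assms(1,2) disj(2)
    by (intro sorted_distinct_set_unique) (auto simp: A_def sorted_filter[of id, simplified])
  moreover obtain F where "F \<in> set_comps (set (drop a ys))" "map card F = \<alpha>" "act F xs = drop a ys"
    using Cons.IH[of "drop a ys"] Cons.prems disj by auto
  moreover have "A \<noteq> {}" using \<open>card A = a\<close> Cons.prems by auto
  ultimately show ?case
    using disj by (intro bexI[of _ "A # F"]) (auto simp: Cons_in_set_comps_iff)
qed simp

definition typed_comps :: "nat \<Rightarrow> nat list \<Rightarrow> nat set list set" where
  "typed_comps n \<alpha> = {G \<in> set_comps {1..n}. comp_type G = \<alpha>}"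

definition shuffles_of :: "nat \<Rightarrow> nat list \<Rightarrow> (nat \<Rightarrow> nat) set" where
  "shuffles_of n \<alpha> = {w. w permutes {1..n} \<and> descents n w \<subseteq> comp_set \<alpha>}"

text \<open>A permutation that increases on each segment is determined by the sets of its values
  there; acting on the identity word lists each of these sets in increasing order.\<close>

lemma word_image_shuffles:
  assumes "is_composition n \<alpha>"
  shows "word n ` shuffles_of n \<alpha> = (\<lambda>G. act G [1..<Suc n]) ` typed_comps n \<alpha>"
proof (intro Set.set_eqI iffI)
  let ?xs = "[1..<Suc n]"
  have xs: "set ?xs = {1..n}" "distinct ?xs" "sorted ?xs"
    by (simp_all add: atLeastLessThanSuc_atLeastAtMost del: upt_Suc)
  have \<alpha>: "sum_list \<alpha> = n" "\<forall>a\<in>set \<alpha>. 0 < a"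
    using assms by (auto simp: is_composition_def)
  {
    fix ys assume "ys \<in> word n ` shuffles_of n \<alpha>"
    then obtain w where w: "w permutes {1..n}" "chunks_sorted \<alpha> ys" "ys = word n w"
      using \<alpha> by (auto simp: shuffles_of_def descents_subset_comp_set_iff)
    then have "set ys = {1..n}" "distinct ys" "length ys = n"
      by (simp_all add: set_word distinct_word length_word)
    then show "ys \<in> (\<lambda>G. act G ?xs) ` typed_comps n \<alpha>"
      using ex_act_eq[of ?xs ys \<alpha>] w(2) \<alpha> xs
      unfolding typed_comps_def comp_type_def by (metis (lifting) imageI mem_Collect_eq order_refl)
  next
    fix ys assume "ys \<in> (\<lambda>G. act G ?xs) ` typed_comps n \<alpha>"
    then obtain G where G: "G \<in> set_comps {1..n}" "map card G = \<alpha>" "ys = act G ?xs"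
      by (auto simp: typed_comps_def comp_type_def)
    then have "distinct ys" "set ys = {1..n}"
      using distinct_act[of G "{1..n}" ?xs] set_act[of G "{1..n}" ?xs] xs by auto
    then obtain w where w: "w permutes {1..n}" "word n w = ys"
      by (rule ex_word_eq)
    moreover have "\<forall>A\<in>set G. A \<subseteq> set ?xs"
      using G xs(1) by (auto simp: set_comps_def simp del: upt_Suc)
    then have "chunks_sorted \<alpha> ys"
      using chunks_sorted_act[of ?xs G] xs(2,3) G by simp
    ultimately show "ys \<in> word n ` shuffles_of n \<alpha>"
      using \<alpha> by (auto simp: shuffles_of_def descents_subset_comp_set_iff)
  }
qed

lemma map_image_in_set_comps:
  assumes "inj f" "F \<in> set_comps X" shows "map ((`) f) F \<in> set_comps (f ` X)"
proof -
  have "sorted_wrt (\<lambda>A B. f ` A \<inter> f ` B = {}) F"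
    using assms by (auto simp: set_comps_def image_Int[symmetric])
  then show ?thesis
    using assms by (auto simp: set_comps_def sorted_wrt_map)
qed

lemma map_image_in_typed_comps:
  assumes "w permutes {1..n}" "G \<in> typed_comps n \<alpha>"
  shows "map ((`) w) G \<in> typed_comps n \<alpha>"
proof -
  have inj: "inj w" using assms(1) by (rule permutes_inj)
  then have "card (w ` A) = card A" for A
    by (intro card_image) (auto intro: inj_on_subset)
  then show ?thesis
    using assms map_image_in_set_comps[OF inj, of G "{1..n}"]
    by (simp add: typed_comps_def comp_type_def permutes_image o_def)
qed

text \<open>Right multiplication by B_\<alpha> becomes the action of all set compositions of type
  \<alpha>. The case of the identity word is \<open>word_image_shuffles\<close>; equivariance moves
  \<open>w\<close> inside the action.\<close>

lemma sum_shuffles_word: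
  fixes h :: "nat list \<Rightarrow> int"
  assumes "is_composition n \<alpha>" "w permutes {1..n}"
  shows "(\<Sum>v\<in>shuffles_of n \<alpha>. h (word n (w \<circ> v))) = (\<Sum>G\<in>typed_comps n \<alpha>. h (act G (word n w)))"
proof -
  let ?xs = "[1..<Suc n]"
  have inj: "inj_on (word n) (shuffles_of n \<alpha>)"
    by (rule inj_on_subset[OF inj_on_word]) (auto simp: shuffles_of_def)
  have inj': "inj_on (\<lambda>G. act G ?xs) (typed_comps n \<alpha>)"
    using inj_on_act[of ?xs \<alpha>]
    by (simp add: typed_comps_def comp_type_def atLeastLessThanSuc_atLeastAtMost del: upt_Suc)
  have w: "inj w" "\<And>i. w (inv' w i) = i" "\<And>i. inv' w (w i) = i"
    using assms(2) by (auto simp: permutes_inj permutes_inverses)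
  have "(\<Sum>v\<in>shuffles_of n \<alpha>. h (word n (w \<circ> v))) = (\<Sum>ys\<in>word n ` shuffles_of n \<alpha>. h (map w ys))"
    by (simp add: sum.reindex[OF inj] word_comp)
  also have "\<dots> = (\<Sum>G\<in>typed_comps n \<alpha>. h (map w (act G ?xs)))"
    unfolding word_image_shuffles[OF assms(1)] by (simp only: sum.reindex[OF inj'] o_def)
  also have "\<dots> = (\<Sum>G\<in>typed_comps n \<alpha>. h (act (map ((`) w) G) (word n w)))"
    by (simp add: word_def act_map_image[OF w(1)] del: upt_Suc)
  \<comment> \<open>Applying \<open>w\<close> to all blocks permutes the set compositions of type
    \<alpha>, with inverse given by \<open>inv' w\<close>.\<close>
  also have "\<dots> = (\<Sum>G\<in>typed_comps n \<alpha>. h (act G (word n w)))"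
    using assms(2) w
    by (intro sum.reindex_bij_witness[of _ "map ((`) (inv' w))" "map ((`) w)"])
      (auto simp: map_image_in_typed_comps permutes_inv image_image o_def)
  finally show ?thesis .
qed

section \<open>The level filtration\<close>

text \<open>\<open>f\<close> stands for the group algebra element with coefficients
  \<open>f w\<close>, to which the action of \<open>F\<close> extends linearly. Letting the test
  function \<open>g\<close> vary detects every coefficient of the result.\<close>

definition pairing :: "nat \<Rightarrow> nat set list \<Rightarrow> ((nat \<Rightarrow> nat) \<Rightarrow> int) \<Rightarrow> (nat list \<Rightarrow> int) \<Rightarrow> int" where
  "pairing n F f g = (\<Sum>w | w permutes {1..n}. f w * g (act F (word n w)))"

text \<open>A product with \<open>v\<close> on the right has coefficient
  \<open>f (w \<circ> inv' v)\<close> at \<open>w\<close>; here \<open>v\<close> is the longest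
  permutation, its own inverse.\<close>

definition rmul_w0 :: "nat \<Rightarrow> ((nat \<Rightarrow> nat) \<Rightarrow> int) \<Rightarrow> (nat \<Rightarrow> nat) \<Rightarrow> int" where
  "rmul_w0 n f w = f (w \<circ> longest_perm n)"

definition rmul_B :: "nat \<Rightarrow> nat list \<Rightarrow> ((nat \<Rightarrow> nat) \<Rightarrow> int) \<Rightarrow> (nat \<Rightarrow> nat) \<Rightarrow> int" where
  "rmul_B n \<alpha> f w = (\<Sum>v\<in>shuffles_of n \<alpha>. f (w \<circ> inv' v))"

lemma longest_perm_involution: "longest_perm n \<circ> longest_perm n = id"
  by (auto simp: longest_perm_def fun_eq_iff)

lemma longest_perm_permutes: "longest_perm n permutes {1..n}"
proof (rule bij_imp_permutes)
  have "longest_perm n (longest_perm n i) = i" for i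
    using longest_perm_involution[of n] by (simp add: fun_eq_iff)
  then show "bij_betw (longest_perm n) {1..n} {1..n}"
    by (intro bij_betw_byWitness[where f' = "longest_perm n"]) (auto simp: longest_perm_def)
qed (auto simp: longest_perm_def)

lemma pairing_diff: "pairing n F (\<lambda>w. f w - k * h w) g = pairing n F f g - k * pairing n F h g"
  by (simp add: pairing_def left_diff_distrib sum_subtractf sum_distrib_left mult.assoc)

lemma finite_typed_comps: "finite (typed_comps n \<alpha>)"
  unfolding typed_comps_def by (rule finite_subset[OF _ finite_set_comps[of "{1..n}"]]) auto

text \<open>Moves B_\<alpha> from \<open>f\<close> to \<open>F\<close>, where it becomes right
  multiplication by the sum of all \<open>G\<close> of type \<alpha>.\<close>

lemma pairing_rmul_B:
  assumes "is_composition n \<alpha>"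
  shows "pairing n F (rmul_B n \<alpha> f) g = (\<Sum>G\<in>typed_comps n \<alpha>. pairing n (face_prod F G) f g)"
proof -
  let ?P = "{w. w permutes {1..n}}"
  have "pairing n F (rmul_B n \<alpha> f) g =
      (\<Sum>v\<in>shuffles_of n \<alpha>. \<Sum>w\<in>?P. f (w \<circ> inv' v) * g (act F (word n w)))"
    unfolding pairing_def rmul_B_def sum_distrib_right by (rule sum.swap)
  \<comment> \<open>For fixed \<open>v\<close>, the substitution of \<open>w \<circ> v\<close> for
    \<open>w\<close> is a bijection of the symmetric group.\<close>
  also have "\<dots> = (\<Sum>v\<in>shuffles_of n \<alpha>. \<Sum>w\<in>?P. f w * g (act F (word n (w \<circ> v))))"
  proof (rule sum.cong[OF refl])
    fix v assume "v \<in> shuffles_of n \<alpha>"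
    then have v: "v permutes {1..n}" by (simp add: shuffles_of_def)
    then have *: "w \<circ> inv' v \<circ> v = w" "w \<circ> v \<circ> inv' v = w" for w :: "nat \<Rightarrow> nat"
      by (simp_all add: o_assoc[symmetric] permutes_inv_o)
    show "(\<Sum>w\<in>?P. f (w \<circ> inv' v) * g (act F (word n w))) =
        (\<Sum>w\<in>?P. f w * g (act F (word n (w \<circ> v))))"
      using v by (intro sum.reindex_bij_witness[of _ "\<lambda>w. w \<circ> v" "\<lambda>w. w \<circ> inv' v"])
        (auto simp: * intro: permutes_compose permutes_inv)
  qed
  also have "\<dots> = (\<Sum>w\<in>?P. f w * (\<Sum>v\<in>shuffles_of n \<alpha>. g (act F (word n (w \<circ> v)))))"
    unfolding sum_distrib_left by (rule sum.swap)
  also have "\<dots> = (\<Sum>w\<in>?P. f w * (\<Sum>G\<in>typed_comps n \<alpha>. g (act F (act G (word n w)))))"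
    by (intro sum.cong refl arg_cong2[of _ _ _ _ "(*)"]
        sum_shuffles_word[OF assms, where h = "\<lambda>xs. g (act F xs)"]) simp
  also have "\<dots> = (\<Sum>G\<in>typed_comps n \<alpha>. pairing n (face_prod F G) f g)"
    unfolding pairing_def sum_distrib_left act_face_prod by (rule sum.swap)
  finally show ?thesis .
qed

lemma pairing_face_prod_of_block_le:
  assumes "G \<in> typed_comps n \<alpha>" "block_le F G"
  shows "pairing n (face_prod F G) f g = pairing n F f g"
proof -
  have "act F (act G xs) = act F xs" for xs
    using assms act_act_of_block_le[of G "{1..n}" F xs] by (simp add: typed_comps_def)
  then show ?thesis by (simp add: pairing_def act_face_prod)
qed

text \<open>After the substitution \<open>w \<circ> longest_perm n\<close> for \<open>w\<close>, the
  face acts on reversed words, which \<open>sum_refinements_act\<close> expands over the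
  subdivisions of \<open>F\<close>.\<close>

lemma pairing_rmul_w0:
  assumes "F \<in> set_comps {1..n}"
  shows "pairing n F (rmul_w0 n f) g =
    (\<Sum>H\<in>refinements F. (- 1) ^ (n - length H) * pairing n H f g)"
proof -
  let ?P = "{w. w permutes {1..n}}"
  have *: "w \<circ> longest_perm n \<circ> longest_perm n = w" for w :: "nat \<Rightarrow> nat"
    by (simp add: o_assoc[symmetric] longest_perm_involution)
  \<comment> \<open>A set composition of \<open>{1..n}\<close> has at most \<open>n\<close> blocks,
    so the natural number subtraction in the exponent is not truncated.\<close>
  have sign: "(- 1 :: int) ^ n * (- 1) ^ length H = (- 1) ^ (n - length H)"
    if "H \<in> refinements F" for H
    using length_set_comps_le[OF refinements_in_set_comps[OF assms that]]
    by (simp add: power_add[symmetric] minus_one_power_iff)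
  have "pairing n F (rmul_w0 n f) g = (\<Sum>w\<in>?P. f w * g (act F (word n (w \<circ> longest_perm n))))"
    unfolding pairing_def rmul_w0_def using longest_perm_permutes[of n]
    by (intro sum.reindex_bij_witness[of _ "\<lambda>w. w \<circ> longest_perm n" "\<lambda>w. w \<circ> longest_perm n"])
      (auto simp: * intro: permutes_compose)
  also have "\<dots> = (\<Sum>w\<in>?P. f w *
      (\<Sum>H\<in>refinements F. (- 1) ^ (n - length H) * g (act H (word n w))))"
  proof (rule sum.cong[OF refl])
    fix w assume "w \<in> ?P"
    then have "(\<Sum>H\<in>refinements F. (- 1) ^ length H * g (act H (word n w))) =
        (- 1) ^ n * g (act F (rev (word n w)))"
      using sum_refinements_act[OF assms, of "word n w" g] by (simp add: set_word distinct_word)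
    then have "g (act F (rev (word n w))) =
        (- 1) ^ n * (\<Sum>H\<in>refinements F. (- 1) ^ length H * g (act H (word n w)))"
      by (simp add: mult.assoc[symmetric] power_add[symmetric])
    also have "\<dots> = (\<Sum>H\<in>refinements F. (- 1) ^ (n - length H) * g (act H (word n w)))"
      by (simp add: sum_distrib_left mult.assoc[symmetric] sign)
    finally show "f w * g (act F (word n (w \<circ> longest_perm n))) = f w *
        (\<Sum>H\<in>refinements F. (- 1) ^ (n - length H) * g (act H (word n w)))"
      by (simp add: word_longest_perm)
  qed
  also have "\<dots> = (\<Sum>H\<in>refinements F. (- 1) ^ (n - length H) * pairing n H f g)"
    unfolding pairing_def sum_distrib_left
    by (subst sum.swap) (simp add: mult.left_commute)
  finally show ?thesis .
qed

section \<open>Counts grow under refinement\<close>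

lemma n_count_eq: "n_count n \<alpha> F = card {G \<in> typed_comps n \<alpha>. block_le F G}"
  by (auto simp: n_count_def typed_comps_def set_compositions_eq intro!: arg_cong[of _ _ card])

lemma n_count_mono: "block_le H F \<Longrightarrow> n_count n \<alpha> F \<le> n_count n \<alpha> H"
  unfolding n_count_eq using finite_typed_comps[of n \<alpha>]
  by (intro card_mono) (auto intro: block_le_trans)

text \<open>The product refines \<open>F\<close>, so nothing counted for \<open>F\<close> is lost,
  and \<open>G\<close> itself is newly counted because the product also refines
  \<open>G\<close>.\<close>

lemma n_count_face_prod:
  assumes "G \<in> typed_comps n \<alpha>" "\<not> block_le F G"
  shows "n_count n \<alpha> F < n_count n \<alpha> (face_prod F G)"
  unfolding n_count_eq
proof (rule psubset_card_mono)
  have "G \<in> {G' \<in> typed_comps n \<alpha>. block_le (face_prod F G) G'}"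
    using assms block_le_face_prod_right by blast
  moreover have "{G' \<in> typed_comps n \<alpha>. block_le F G'} \<subseteq>
      {G' \<in> typed_comps n \<alpha>. block_le (face_prod F G) G'}"
    using block_le_face_prod_left block_le_trans by blast
  ultimately show "{G' \<in> typed_comps n \<alpha>. block_le F G'} \<subset>
      {G' \<in> typed_comps n \<alpha>. block_le (face_prod F G) G'}"
    using assms by blast
qed (use finite_typed_comps[of n \<alpha>] in simp)

section \<open>The filtration by levels\<close>

text \<open>This is the condition of having level at most \<open>K\<close>; vanishing for all
  \<open>g\<close> says that \<open>F\<close> sends \<open>f\<close> to zero.\<close>

definition annihilated :: "nat \<Rightarrow> nat list \<Rightarrow> nat \<Rightarrow> ((nat \<Rightarrow> nat) \<Rightarrow> int) \<Rightarrow> bool" where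
  "annihilated n \<alpha> K f \<longleftrightarrow>
    (\<forall>F\<in>set_comps {1..n}. K \<le> n_count n \<alpha> F \<longrightarrow> (\<forall>g. pairing n F f g = 0))"

lemma annihilatedD:
  "annihilated n \<alpha> K f \<Longrightarrow> F \<in> set_comps {1..n} \<Longrightarrow> K \<le> n_count n \<alpha> F \<Longrightarrow> pairing n F f g = 0"
  by (simp add: annihilated_def)

text \<open>The composition with a single block acts as the identity on words, so the indicator
  function of one word extracts a coefficient of \<open>f\<close>.\<close>

lemma annihilated_0:
  assumes "annihilated n \<alpha> 0 f" "w permutes {1..n}"
  shows "f w = 0"
proof -
  \<comment> \<open>For \<open>n = 0\<close> the single block would be empty, and the only set
    composition is the empty list.\<close>
  define F where "F = (if n = 0 then [] else [{1..n}])"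
  have F: "F \<in> set_comps {1..n}"
    by (simp add: F_def singleton_in_set_comps)
  have act: "act F (word n v) = word n v" if "v permutes {1..n}" for v
    using set_word[OF that] length_word[of n v] by (auto simp: F_def filter_id_conv)
  have "pairing n F f (\<lambda>xs. if xs = word n w then 1 else 0) =
      (\<Sum>v | v permutes {1..n}. if v = w then f w else 0)"
    unfolding pairing_def
    by (intro sum.cong) (use assms(2) inj_on_word[of n] act in \<open>auto simp: inj_on_def\<close>)
  also have "\<dots> = f w"
    using assms(2) by (simp add: finite_permutations)
  finally show ?thesis
    using annihilatedD[OF assms(1) F] by simp
qed

text \<open>Each term in the expansion of the reversal belongs to a subdivision of \<open>F\<close>,
  whose count is at least that of \<open>F\<close>.\<close>

lemma annihilated_rmul_w0:
  assumes "annihilated n \<alpha> K f" shows "annihilated n \<alpha> K (rmul_w0 n f)"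
  unfolding annihilated_def
proof (intro ballI impI allI)
  fix F g assume F: "F \<in> set_comps {1..n}" "K \<le> n_count n \<alpha> F"
  have "pairing n H f g = 0" if "H \<in> refinements F" for H
    using refinements_in_set_comps[OF F(1) that] n_count_mono[OF block_le_refinements[OF that]] F(2)
    by (intro annihilatedD[OF assms]) (auto intro: order_trans)
  then show "pairing n F (rmul_w0 n f) g = 0"
    by (simp add: pairing_rmul_w0[OF F(1)])
qed

text \<open>Those \<open>G\<close> with \<open>block_le F G\<close> contribute equal terms. For
  every other \<open>G\<close> the product has count at least \<open>Suc K\<close>, so its term
  vanishes.\<close>

lemma pairing_rmul_B_top:
  assumes "is_composition n \<alpha>" "annihilated n \<alpha> (Suc K) f" "F \<in> set_comps {1..n}" "K \<le> n_count n \<alpha> F"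
  shows "pairing n F (rmul_B n \<alpha> f) g = int K * pairing n F f g"
proof -
  have "pairing n (face_prod F G) f g = (if block_le F G then pairing n F f g else 0)"
    if G: "G \<in> typed_comps n \<alpha>" for G
  proof (cases "block_le F G")
    case False
    have "face_prod F G \<in> set_comps {1..n}"
      using face_prod_in_set_comps[OF assms(3), of G "{1..n}"] G by (simp add: typed_comps_def)
    then show ?thesis
      using False n_count_face_prod[OF G False] assms(4) by (auto intro: annihilatedD[OF assms(2)])
  qed (simp add: pairing_face_prod_of_block_le[OF G])
  then have "pairing n F (rmul_B n \<alpha> f) g = int (n_count n \<alpha> F) * pairing n F f g"
    by (simp add: pairing_rmul_B[OF assms(1)] n_count_eq sum.inter_filter[symmetric]
        finite_typed_comps)
  \<comment> \<open>If the count of \<open>F\<close> exceeds \<open>K\<close>, the pairing is zero,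
    so the factor may be written as \<open>K\<close> in every case.\<close>
  moreover have "pairing n F f g = 0" if "n_count n \<alpha> F \<noteq> K"
    using that assms(3,4) by (intro annihilatedD[OF assms(2)]) auto
  ultimately show ?thesis by auto
qed

lemma annihilated_rmul_B:
  assumes "is_composition n \<alpha>" "annihilated n \<alpha> (Suc K) f"
  shows "annihilated n \<alpha> (Suc K) (rmul_B n \<alpha> f)"
  unfolding annihilated_def
  using assms pairing_rmul_B_top[OF assms] annihilatedD[OF assms(2)] by simp

section \<open>Lowering the level by factors w_0 B_\<alpha> - k\<close>

definition rmul_w0B :: "nat \<Rightarrow> nat list \<Rightarrow> ((nat \<Rightarrow> nat) \<Rightarrow> int) \<Rightarrow> (nat \<Rightarrow> nat) \<Rightarrow> int" where
  "rmul_w0B n \<alpha> f = rmul_B n \<alpha> (rmul_w0 n f)"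

definition rmul_shift :: "nat \<Rightarrow> nat list \<Rightarrow> int \<Rightarrow> ((nat \<Rightarrow> nat) \<Rightarrow> int) \<Rightarrow> (nat \<Rightarrow> nat) \<Rightarrow> int" where
  "rmul_shift n \<alpha> k f w = rmul_w0B n \<alpha> f w - k * f w"

lemma pairing_rmul_shift:
  "pairing n F (rmul_shift n \<alpha> k f) g = pairing n F (rmul_w0B n \<alpha> f) g - k * pairing n F f g"
  using pairing_diff[of n F "rmul_w0B n \<alpha> f" k f g] by (simp add: rmul_shift_def[abs_def])

lemma rmul_w0B_shift:
  "rmul_w0B n \<alpha> (rmul_shift n \<alpha> k f) w = rmul_w0B n \<alpha> (rmul_w0B n \<alpha> f) w - k * rmul_w0B n \<alpha> f w"
proof -
  have "rmul_w0B n \<alpha> h u = (\<Sum>v\<in>shuffles_of n \<alpha>. h (u \<circ> inv' v \<circ> longest_perm n))" for h u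
    by (simp add: rmul_w0B_def rmul_B_def rmul_w0_def)
  then show ?thesis
    by (simp add: rmul_shift_def sum_subtractf sum_distrib_left)
qed

context
  fixes n \<alpha> K f
  assumes \<alpha>: "is_composition n \<alpha>" and f: "annihilated n \<alpha> (Suc K) f"
begin

lemma pairing_rmul_w0B_top:
  assumes "F \<in> set_comps {1..n}" "K \<le> n_count n \<alpha> F"
  shows "pairing n F (rmul_w0B n \<alpha> f) g = int K * pairing n F (rmul_w0 n f) g"
  unfolding rmul_w0B_def
  by (intro pairing_rmul_B_top annihilated_rmul_w0 \<alpha> f assms)

text \<open>B_\<alpha> acts by the scalar \<open>K\<close> at \<open>F\<close> and at all its
  subdivisions, so one scalar can be pulled out of the expansion of the inner reversal. The two
  reversals then cancel.\<close>

lemma pairing_rmul_w0B_twice: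
  assumes F: "F \<in> set_comps {1..n}" "K \<le> n_count n \<alpha> F"
  shows "pairing n F (rmul_w0B n \<alpha> (rmul_w0B n \<alpha> f)) g = int K * (int K * pairing n F f g)"
proof -
  have "annihilated n \<alpha> (Suc K) (rmul_w0 n (rmul_w0B n \<alpha> f))"
    unfolding rmul_w0B_def by (intro annihilated_rmul_w0 annihilated_rmul_B \<alpha> f)
  then have "pairing n F (rmul_w0B n \<alpha> (rmul_w0B n \<alpha> f)) g =
      int K * pairing n F (rmul_w0 n (rmul_w0B n \<alpha> f)) g"
    unfolding rmul_w0B_def[of n \<alpha> "rmul_w0B n \<alpha> f"] using pairing_rmul_B_top[OF \<alpha> _ F] by simp
  also have "pairing n F (rmul_w0 n (rmul_w0B n \<alpha> f)) g =
      (\<Sum>H\<in>refinements F. (- 1) ^ (n - length H) * (int K * pairing n H (rmul_w0 n f) g))"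
    unfolding pairing_rmul_w0[OF F(1)]
  proof (intro sum.cong refl arg_cong2[of _ _ _ _ "(*)"] pairing_rmul_w0B_top)
    fix H assume H: "H \<in> refinements F"
    show "H \<in> set_comps {1..n}" by (rule refinements_in_set_comps[OF F(1) H])
    show "K \<le> n_count n \<alpha> H"
      using F(2) n_count_mono[OF block_le_refinements[OF H], of n \<alpha>] by simp
  qed
  also have "\<dots> = int K * pairing n F (rmul_w0 n (rmul_w0 n f)) g"
    by (simp add: pairing_rmul_w0[OF F(1)] sum_distrib_left mult.left_commute)
  also have "rmul_w0 n (rmul_w0 n f) = f"
    by (simp add: rmul_w0_def fun_eq_iff o_assoc[symmetric] longest_perm_involution)
  finally show ?thesis .
qed

text \<open>With x for w_0 B_\<alpha>, the product (x - K)(x + K) equals x^2 - K^2, which kills the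
  top layer.\<close>

lemma annihilated_both_signs:
  "annihilated n \<alpha> K (rmul_shift n \<alpha> (- int K) (rmul_shift n \<alpha> (int K) f))"
proof -
  have "rmul_shift n \<alpha> (- int K) (rmul_shift n \<alpha> (int K) f) =
      (\<lambda>w. rmul_w0B n \<alpha> (rmul_w0B n \<alpha> f) w - (int K * int K) * f w)"
    by (simp add: fun_eq_iff rmul_shift_def[of n \<alpha> "- int K"] rmul_w0B_shift)
      (simp add: rmul_shift_def algebra_simps)
  then show ?thesis
    by (simp add: annihilated_def pairing_diff pairing_rmul_w0B_twice)
qed

text \<open>If \<open>H\<close> strictly refines \<open>F\<close> with the same count, then so does some intermediate composition
  with one block more than \<open>F\<close>, and its signed count is the negative of that of \<open>F\<close>.\<close>

lemma annihilated_one_sign: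
  assumes k: "\<And>F. F \<in> set_comps {1..n} \<Longrightarrow> n_count n \<alpha> F = K \<Longrightarrow> signed_n_count n \<alpha> F = k"
  shows "annihilated n \<alpha> K (rmul_shift n \<alpha> k f)"
  unfolding annihilated_def
proof (intro ballI impI allI)
  fix F g assume F: "F \<in> set_comps {1..n}" "K \<le> n_count n \<alpha> F"
  have fin: "finite (refinements F)"
    using F by (intro finite_refinements) (auto simp: set_comps_def intro: finite_subset)
  have ne: "{} \<notin> set F" using F by (simp add: set_comps_def)
  show "pairing n F (rmul_shift n \<alpha> k f) g = 0"
  proof (cases "n_count n \<alpha> F = K")
    case True
    \<comment> \<open>The factor \<open>int K\<close> belongs to the claim: when a proper
      subdivision has the same count, it is \<open>K\<close> that turns out to be zero, not
      necessarily the pairing.\<close>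
    have zero: "int K * pairing n H f g = 0" if H: "H \<in> refinements F" "H \<noteq> F" for H
    proof (cases "n_count n \<alpha> H = K")
      case True': True
      obtain F' where F': "F' \<in> refinements F" "block_le H F'" "length F' = Suc (length F)"
        using refinements_intermediate[OF H ne] by blast
      have F'': "F' \<in> set_comps {1..n}"
        using refinements_in_set_comps[OF F(1) F'(1)] .
      have "n_count n \<alpha> F' = K"
        using n_count_mono[OF block_le_refinements[OF F'(1)], of n \<alpha>] n_count_mono[OF F'(2), of n \<alpha>]
          True True' by simp
      then have "signed_n_count n \<alpha> F' = signed_n_count n \<alpha> F"
        using k[OF F''] k[OF F(1) True] by simp
      moreover have "Suc (length F) \<le> n"
        using length_set_comps_le[OF F''] F'(3) by simp
      \<comment> \<open>The exponents differ by one, so the equal signed counts of \<open>F\<close>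
        and \<open>F'\<close> are also opposite, which forces \<open>K = 0\<close>.\<close>
      then have "n - length F = Suc (n - length F')"
        using F'(3) by simp
      ultimately show ?thesis
        using \<open>n_count n \<alpha> F' = K\<close> True by (simp add: signed_n_count_def)
    next
      case False
      then have "Suc K \<le> n_count n \<alpha> H"
        using F(2) n_count_mono[OF block_le_refinements[OF H(1)], of n \<alpha>] by simp
      then show ?thesis
        by (simp add: annihilatedD[OF f refinements_in_set_comps[OF F(1) H(1)]])
    qed
    have "pairing n F (rmul_w0B n \<alpha> f) g =
        (\<Sum>H\<in>refinements F. (- 1) ^ (n - length H) * (int K * pairing n H f g))"
      unfolding pairing_rmul_w0B_top[OF F] pairing_rmul_w0[OF F(1)]
      by (simp add: sum_distrib_left mult.left_commute)
    \<comment> \<open>Only the trivial subdivision survives, and its sign times \<open>K\<close> is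
      the signed count of \<open>F\<close>.\<close>
    also have "\<dots> = (\<Sum>H\<in>{F}. (- 1) ^ (n - length H) * (int K * pairing n H f g))"
      using fin self_in_refinements[OF ne] zero by (intro sum.mono_neutral_right) auto
    also have "\<dots> = k * pairing n F f g"
      using k[OF F(1) True] True by (simp add: signed_n_count_def)
    finally show ?thesis
      by (simp add: pairing_rmul_shift)
  next
    case False
    then have "Suc K \<le> n_count n \<alpha> F" using F by simp
    moreover have "annihilated n \<alpha> (Suc K) (rmul_w0B n \<alpha> f)"
      unfolding rmul_w0B_def by (intro annihilated_rmul_w0 annihilated_rmul_B \<alpha> f)
    ultimately show ?thesis
      using F(1) f by (simp add: pairing_rmul_shift annihilatedD)
  qed
qed

end

section \<open>The product over all signed counts\<close>

text \<open>The elements of \<open>S\<close> of absolute value \<open>K\<close>, each once; zero is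
  separate because there the two signs coincide.\<close>

definition sign_block :: "int set \<Rightarrow> nat \<Rightarrow> int list" where
  "sign_block S K = filter (\<lambda>k. k \<in> S) (if K = 0 then [0] else [int K, - int K])"

text \<open>If both signs occur, the quadratic relation applies; if only one occurs, a single factor
  is enough; if none occurs, levels \<open>Suc K\<close> and \<open>K\<close> coincide.\<close>

lemma annihilated_sign_block:
  assumes "is_composition n \<alpha>" "annihilated n \<alpha> (Suc K) f"
  shows "annihilated n \<alpha> K
    (fold (rmul_shift n \<alpha>) (sign_block (signed_n_count n \<alpha> ` set_comps {1..n}) K) f)"
proof -
  define S where "S = signed_n_count n \<alpha> ` set_comps {1..n}"
  have mem: "signed_n_count n \<alpha> F \<in> S" "signed_n_count n \<alpha> F \<in> {int K, - int K}"
    if "F \<in> set_comps {1..n}" "n_count n \<alpha> F = K" for F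
    using that by (auto simp: S_def signed_n_count_def minus_one_power_iff)
  consider "int K \<in> S" "- int K \<in> S" | "int K \<in> S" "- int K \<notin> S"
    | "int K \<notin> S" "- int K \<in> S" | "int K \<notin> S" "- int K \<notin> S"
    by blast
  then have "annihilated n \<alpha> K (fold (rmul_shift n \<alpha>) (sign_block S K) f)"
  proof cases
    case 1
    show ?thesis
    proof (cases "K = 0")
      \<comment> \<open>Both memberships concern the same number 0, so the block has one factor;
        every composition of count zero has signed count 0.\<close>
      case True
      then have "annihilated n \<alpha> K (rmul_shift n \<alpha> 0 f)"
        using assms by (intro annihilated_one_sign) (auto simp: signed_n_count_def)
      then show ?thesis using 1 True by (simp add: sign_block_def)
    next
      case False
      then show ?thesis
        using 1 annihilated_both_signs[OF assms] by (simp add: sign_block_def)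
    qed
  next
    case 2
    then have "annihilated n \<alpha> K (rmul_shift n \<alpha> (int K) f)"
      using assms mem 2 by (intro annihilated_one_sign) force+
    then show ?thesis using 2 by (auto simp: sign_block_def)
  next
    case 3
    then have "annihilated n \<alpha> K (rmul_shift n \<alpha> (- int K) f)"
      using assms mem 3 by (intro annihilated_one_sign) force+
    then show ?thesis using 3 by (auto simp: sign_block_def)
  next
    case 4
    \<comment> \<open>A composition of count \<open>K\<close> would put one of the two signed values
      into \<open>S\<close>.\<close>
    then have "n_count n \<alpha> F \<noteq> K" if "F \<in> set_comps {1..n}" for F
      using mem[OF that] by auto
    then have "annihilated n \<alpha> K f"
      using assms(2) unfolding annihilated_def by (metis Suc_leI le_neq_implies_less)
    then show ?thesis using 4 by (auto simp: sign_block_def)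
  qed
  then show ?thesis by (simp add: S_def)
qed

text \<open>Every element starts at a level above all counts, and each block of factors lowers the
  level by one until it reaches 0.\<close>

lemma fold_rmul_shift_eq_0:
  assumes "is_composition n \<alpha>"
  obtains ks where "distinct ks" "set ks = signed_n_count n \<alpha> ` set_comps {1..n}"
    "\<And>f w. w permutes {1..n} \<Longrightarrow> fold (rmul_shift n \<alpha>) ks f w = 0"
proof -
  define S where "S = signed_n_count n \<alpha> ` set_comps {1..n}"
  \<comment> \<open>The list is reversed because \<open>fold\<close> applies its first operator
    first and the level has to fall from the top.\<close>
  define ks where "ks M = concat (map (sign_block S) (rev [0..<M]))" for M
  \<comment> \<open>No count reaches this bound, so having level at most \<open>N\<close> is
    vacuous.\<close>
  define N where "N = Suc (card (typed_comps n \<alpha>))"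
  have ks_Suc: "ks (Suc M) = sign_block S M @ ks M" for M
    by (simp add: ks_def)
  have block: "set (sign_block S K) = {k \<in> S. \<bar>k\<bar> = int K}" "distinct (sign_block S K)" for K
    by (auto simp: sign_block_def abs_if)
  have ks: "set (ks M) = {k \<in> S. \<bar>k\<bar> < int M} \<and> distinct (ks M)" for M
  proof (induction M)
    case (Suc M)
    have "{k \<in> S. \<bar>k\<bar> < int (Suc M)} = {k \<in> S. \<bar>k\<bar> = int M} \<union> {k \<in> S. \<bar>k\<bar> < int M}"
      by auto
    moreover have "{k \<in> S. \<bar>k\<bar> = int M} \<inter> {k \<in> S. \<bar>k\<bar> < int M} = {}"
      by auto
    ultimately show ?case
      using Suc by (simp add: ks_Suc block)
  qed (simp add: ks_def)
  have ann: "annihilated n \<alpha> 0 (fold (rmul_shift n \<alpha>) (ks M) f)" if "annihilated n \<alpha> M f" for M f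
    using that
  proof (induction M arbitrary: f)
    case (Suc M)
    then show ?case
      using annihilated_sign_block[OF assms Suc.prems] by (simp add: ks_Suc S_def)
  qed (simp add: ks_def)
  have le: "n_count n \<alpha> F < N" for F
    unfolding n_count_eq N_def less_Suc_eq_le
    by (rule card_mono[OF finite_typed_comps]) auto
  have "\<bar>k\<bar> < int N" if "k \<in> S" for k
    using that le by (auto simp: S_def signed_n_count_def abs_mult power_abs)
  then have "set (ks N) = S" using ks[of N] by auto
  moreover have "annihilated n \<alpha> N f" for f
    unfolding annihilated_def using le by (meson leD)
  ultimately show ?thesis
    using that[of "ks N"] ks[of N] annihilated_0[OF ann] by (simp add: S_def)
qed

section \<open>Group algebras\<close>

lemma (in abelian_monoid) finsum_swap:
  assumes "finite A" "finite B" "\<And>x y. x \<in> A \<Longrightarrow> y \<in> B \<Longrightarrow> f x y \<in> carrier G"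
  shows "(\<Oplus>x\<in>A. \<Oplus>y\<in>B. f x y) = (\<Oplus>y\<in>B. \<Oplus>x\<in>A. f x y)"
  using assms(1,3)
proof (induction A)
  case (insert a A)
  have "(\<Oplus>x\<in>insert a A. \<Oplus>y\<in>B. f x y) = (\<Oplus>y\<in>B. f a y) \<oplus> (\<Oplus>y\<in>B. \<Oplus>x\<in>A. f x y)"
    using insert by (subst finsum_insert) (auto intro!: finsum_closed)
  also have "\<dots> = (\<Oplus>y\<in>B. f a y \<oplus> (\<Oplus>x\<in>A. f x y))"
    using insert by (intro finsum_addf[symmetric]) (auto intro!: finsum_closed)
  also have "\<dots> = (\<Oplus>y\<in>B. \<Oplus>x\<in>insert a A. f x y)"
    using insert by (intro finsum_cong') (auto intro!: finsum_closed)
  finally show ?case .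
qed simp

lemma (in ring) commute_minus:
  assumes "a \<in> carrier R" "b \<in> carrier R" "c \<in> carrier R" "a \<otimes> b = b \<otimes> a" "a \<otimes> c = c \<otimes> a"
  shows "a \<otimes> (b \<ominus> c) = (b \<ominus> c) \<otimes> a"
  using assms by (simp add: minus_eq r_distr l_distr r_minus l_minus)

lemma (in ring) commute_int:
  assumes "a \<in> carrier R" shows "a \<otimes> ([(k::int)] \<cdot> \<one>) = ([k] \<cdot> \<one>) \<otimes> a"
  using assms by (simp add: add_pow_ldistr_int add_pow_rdistr_int)

lemma (in ring) commute_shifts:
  assumes "x \<in> carrier R"
  shows "(x \<ominus> ([(k::int)] \<cdot> \<one>)) \<otimes> (x \<ominus> ([(l::int)] \<cdot> \<one>)) = (x \<ominus> ([l] \<cdot> \<one>)) \<otimes> (x \<ominus> ([k] \<cdot> \<one>))"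
proof (rule commute_minus)
  show "(x \<ominus> ([k] \<cdot> \<one>)) \<otimes> x = x \<otimes> (x \<ominus> ([k] \<cdot> \<one>))"
    using assms by (intro commute_minus[symmetric] commute_int) auto
  show "(x \<ominus> ([k] \<cdot> \<one>)) \<otimes> ([l] \<cdot> \<one>) = ([l] \<cdot> \<one>) \<otimes> (x \<ominus> ([k] \<cdot> \<one>))"
    using assms by (intro commute_int) auto
qed (use assms in auto)

lemma (in ring) finprod_shifts:
  assumes "x \<in> carrier R" "distinct ks"
  shows "(\<Otimes>k\<in>set ks. x \<ominus> ([(k::int)] \<cdot> \<one>)) = foldr (\<lambda>k z. (x \<ominus> ([k] \<cdot> \<one>)) \<otimes> z) ks \<one>"
  using assms by (intro finprod_commuting_factors commute_shifts) auto

lemma (in ring) foldr_shifts_closed: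
  assumes "x \<in> carrier R"
  shows "foldr (\<lambda>k z. (x \<ominus> ([(k::int)] \<cdot> \<one>)) \<otimes> z) ks \<one> \<in> carrier R"
  using assms by (induction ks) auto

text \<open>Since \<open>w\<close> squares to one, b w - k = w (w b - k) w, and the inner copies of
  \<open>w\<close> cancel between neighbouring factors.\<close>

lemma (in ring) foldr_shifts_conj:
  assumes "w \<in> carrier R" "b \<in> carrier R" "w \<otimes> w = \<one>"
  shows "foldr (\<lambda>k z. (b \<otimes> w \<ominus> ([(k::int)] \<cdot> \<one>)) \<otimes> z) ks \<one> =
    w \<otimes> foldr (\<lambda>k z. (w \<otimes> b \<ominus> ([k] \<cdot> \<one>)) \<otimes> z) ks \<one> \<otimes> w"
proof (induction ks)
  case Nil
  then show ?case using assms by simp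
next
  case (Cons k ks)
  define z where "z = foldr (\<lambda>k z. (w \<otimes> b \<ominus> ([k] \<cdot> \<one>)) \<otimes> z) ks \<one>"
  have z: "z \<in> carrier R" using assms foldr_shifts_closed[of "w \<otimes> b"] by (simp add: z_def)
  have ww: "w \<otimes> (w \<otimes> y) = y" if "y \<in> carrier R" for y
    using assms that by (simp add: m_assoc[symmetric])
  have "(b \<otimes> w \<ominus> ([k] \<cdot> \<one>)) = w \<otimes> (w \<otimes> b \<ominus> ([k] \<cdot> \<one>)) \<otimes> w"
    using assms ww by (simp add: minus_eq r_distr l_distr r_minus l_minus m_assoc commute_int[symmetric])
  then have "(b \<otimes> w \<ominus> ([k] \<cdot> \<one>)) \<otimes> (w \<otimes> z \<otimes> w) = w \<otimes> ((w \<otimes> b \<ominus> ([k] \<cdot> \<one>)) \<otimes> z) \<otimes> w"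
    using assms z ww by (simp add: m_assoc)
  then show ?case using Cons by (simp add: z_def)
qed

section \<open>The group algebra of a finite group is a ring\<close>

context
  fixes R :: "('k, 'm) ring_scheme" and G :: "('g, 'n) monoid_scheme"
  assumes R: "ring R" and G: "group G" and fin: "finite (carrier G)"
begin

interpretation R: ring R by (rule R)
interpretation G: group G by (rule G)

lemma group_algebra_mult:
  "f \<otimes>\<^bsub>group_algebra R G\<^esub> g = (\<lambda>x\<in>carrier G. \<Oplus>\<^bsub>R\<^esub>y\<in>carrier G. f y \<otimes>\<^bsub>R\<^esub> g (inv\<^bsub>G\<^esub> y \<otimes>\<^bsub>G\<^esub> x))"
  by (simp add: group_algebra_def)

lemma ga_basis_closed: "ga_basis R G w \<in> carrier (group_algebra R G)"
  by (auto simp: group_algebra_def ga_basis_def)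

lemma group_algebra_one: "\<one>\<^bsub>group_algebra R G\<^esub> = ga_basis R G \<one>\<^bsub>G\<^esub>"
  by (simp add: group_algebra_def ga_basis_def)

lemma group_algebra_app_closed: "f \<in> carrier (group_algebra R G) \<Longrightarrow> x \<in> carrier G \<Longrightarrow> f x \<in> carrier R"
  by (auto simp: group_algebra_def)

lemma group_algebra_mult_closed: "f \<in> carrier (group_algebra R G) \<Longrightarrow> g \<in> carrier (group_algebra R G) \<Longrightarrow> f \<otimes>\<^bsub>group_algebra R G\<^esub> g \<in> carrier (group_algebra R G)"
  by (auto simp: group_algebra_def Pi_iff intro!: R.finsum_closed)

lemma group_algebra_eqI:
  "f \<in> carrier (group_algebra R G) \<Longrightarrow> g \<in> carrier (group_algebra R G) \<Longrightarrow> (\<And>x. x \<in> carrier G \<Longrightarrow> f x = g x) \<Longrightarrow> f = g"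
  by (auto simp: group_algebra_def intro: PiE_ext)

text \<open>In the convolution sum only the term with y = x w^-1 survives.\<close>

lemma mult_ga_basis:
  assumes "f \<in> carrier (group_algebra R G)" "w \<in> carrier G"
  shows "f \<otimes>\<^bsub>group_algebra R G\<^esub> ga_basis R G w = (\<lambda>x\<in>carrier G. f (x \<otimes>\<^bsub>G\<^esub> inv\<^bsub>G\<^esub> w))"
  unfolding group_algebra_mult
proof (rule restrict_ext)
  fix x assume x: "x \<in> carrier G"
  have "(\<Oplus>\<^bsub>R\<^esub>y\<in>carrier G. f y \<otimes>\<^bsub>R\<^esub> ga_basis R G w (inv\<^bsub>G\<^esub> y \<otimes>\<^bsub>G\<^esub> x)) =
      (\<Oplus>\<^bsub>R\<^esub>y\<in>carrier G. if x \<otimes>\<^bsub>G\<^esub> inv\<^bsub>G\<^esub> w = y then f y else \<zero>\<^bsub>R\<^esub>)"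
  proof (rule R.finsum_cong')
    fix y assume y: "y \<in> carrier G"
    have "inv\<^bsub>G\<^esub> y \<otimes>\<^bsub>G\<^esub> x = w \<longleftrightarrow> x \<otimes>\<^bsub>G\<^esub> inv\<^bsub>G\<^esub> w = y"
      using x y assms(2) by (metis G.inv_closed G.inv_solve_left G.inv_solve_right)
    then show "f y \<otimes>\<^bsub>R\<^esub> ga_basis R G w (inv\<^bsub>G\<^esub> y \<otimes>\<^bsub>G\<^esub> x) =
        (if x \<otimes>\<^bsub>G\<^esub> inv\<^bsub>G\<^esub> w = y then f y else \<zero>\<^bsub>R\<^esub>)"
      using x y group_algebra_app_closed[OF assms(1) y] by (simp add: ga_basis_def)
  qed (auto intro: group_algebra_app_closed[OF assms(1)])
  also have "\<dots> = f (x \<otimes>\<^bsub>G\<^esub> inv\<^bsub>G\<^esub> w)"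
    using x assms fin by (intro R.finsum_singleton) (auto intro: group_algebra_app_closed)
  finally show "(\<Oplus>\<^bsub>R\<^esub>y\<in>carrier G. f y \<otimes>\<^bsub>R\<^esub> ga_basis R G w (inv\<^bsub>G\<^esub> y \<otimes>\<^bsub>G\<^esub> x)) =
      f (x \<otimes>\<^bsub>G\<^esub> inv\<^bsub>G\<^esub> w)" .
qed

lemma one_mult_group_algebra:
  assumes "f \<in> carrier (group_algebra R G)" shows "\<one>\<^bsub>group_algebra R G\<^esub> \<otimes>\<^bsub>group_algebra R G\<^esub> f = f"
proof (rule group_algebra_eqI)
  fix x assume x: "x \<in> carrier G"
  have "(\<one>\<^bsub>group_algebra R G\<^esub> \<otimes>\<^bsub>group_algebra R G\<^esub> f) x = (\<Oplus>\<^bsub>R\<^esub>y\<in>carrier G. if \<one>\<^bsub>G\<^esub> = y then f (inv\<^bsub>G\<^esub> y \<otimes>\<^bsub>G\<^esub> x) else \<zero>\<^bsub>R\<^esub>)"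
    using x assms unfolding group_algebra_mult group_algebra_one
    by (auto simp: ga_basis_def group_algebra_app_closed intro!: R.finsum_cong')
  also have "\<dots> = f (inv\<^bsub>G\<^esub> \<one>\<^bsub>G\<^esub> \<otimes>\<^bsub>G\<^esub> x)"
    using x assms fin by (intro R.finsum_singleton) (auto intro: group_algebra_app_closed)
  finally show "(\<one>\<^bsub>group_algebra R G\<^esub> \<otimes>\<^bsub>group_algebra R G\<^esub> f) x = f x" using x by simp
qed (use assms in \<open>auto simp: group_algebra_one intro: group_algebra_mult_closed ga_basis_closed\<close>)

lemma group_algebra_mult_assoc:
  assumes "f \<in> carrier (group_algebra R G)" "g \<in> carrier (group_algebra R G)" "h \<in> carrier (group_algebra R G)"
  shows "(f \<otimes>\<^bsub>group_algebra R G\<^esub> g) \<otimes>\<^bsub>group_algebra R G\<^esub> h = f \<otimes>\<^bsub>group_algebra R G\<^esub> (g \<otimes>\<^bsub>group_algebra R G\<^esub> h)"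
proof (rule group_algebra_eqI)
  fix x assume x: "x \<in> carrier G"
  note closed = assms[THEN group_algebra_app_closed]
  have "((f \<otimes>\<^bsub>group_algebra R G\<^esub> g) \<otimes>\<^bsub>group_algebra R G\<^esub> h) x = (\<Oplus>\<^bsub>R\<^esub>z\<in>carrier G. \<Oplus>\<^bsub>R\<^esub>y\<in>carrier G.
      f y \<otimes>\<^bsub>R\<^esub> g (inv\<^bsub>G\<^esub> y \<otimes>\<^bsub>G\<^esub> z) \<otimes>\<^bsub>R\<^esub> h (inv\<^bsub>G\<^esub> z \<otimes>\<^bsub>G\<^esub> x))"
    unfolding group_algebra_mult using x fin closed
    by (auto simp: R.finsum_ldistr intro!: R.finsum_cong' R.finsum_closed)
  also have "\<dots> = (\<Oplus>\<^bsub>R\<^esub>y\<in>carrier G. \<Oplus>\<^bsub>R\<^esub>z\<in>carrier G.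
      f y \<otimes>\<^bsub>R\<^esub> g (inv\<^bsub>G\<^esub> y \<otimes>\<^bsub>G\<^esub> z) \<otimes>\<^bsub>R\<^esub> h (inv\<^bsub>G\<^esub> z \<otimes>\<^bsub>G\<^esub> x))"
    using x fin closed by (intro R.finsum_swap) auto
  also have "\<dots> = (\<Oplus>\<^bsub>R\<^esub>y\<in>carrier G. f y \<otimes>\<^bsub>R\<^esub>
      (\<Oplus>\<^bsub>R\<^esub>z\<in>carrier G. g z \<otimes>\<^bsub>R\<^esub> h (inv\<^bsub>G\<^esub> z \<otimes>\<^bsub>G\<^esub> (inv\<^bsub>G\<^esub> y \<otimes>\<^bsub>G\<^esub> x))))"
  proof (rule R.finsum_cong'[OF refl])
    fix y assume y: "y \<in> carrier G"
    let ?t = "\<lambda>z. f y \<otimes>\<^bsub>R\<^esub> g (inv\<^bsub>G\<^esub> y \<otimes>\<^bsub>G\<^esub> z) \<otimes>\<^bsub>R\<^esub> h (inv\<^bsub>G\<^esub> z \<otimes>\<^bsub>G\<^esub> x)"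
    \<comment> \<open>Left translation by \<open>y\<close> permutes the group, so \<open>z\<close>
      may be replaced by the product of \<open>y\<close> and \<open>z\<close>.\<close>
    have "(\<Oplus>\<^bsub>R\<^esub>z\<in>carrier G. ?t z) = (\<Oplus>\<^bsub>R\<^esub>z\<in>(\<otimes>\<^bsub>G\<^esub>) y ` carrier G. ?t z)"
      using y by (simp add: G.surj_const_mult)
    also have "\<dots> = (\<Oplus>\<^bsub>R\<^esub>z\<in>carrier G. ?t (y \<otimes>\<^bsub>G\<^esub> z))"
      using x y closed by (intro R.finsum_reindex) (auto simp: G.inj_on_cmult)
    also have "\<dots> = (\<Oplus>\<^bsub>R\<^esub>z\<in>carrier G. f y \<otimes>\<^bsub>R\<^esub>
        (g z \<otimes>\<^bsub>R\<^esub> h (inv\<^bsub>G\<^esub> z \<otimes>\<^bsub>G\<^esub> (inv\<^bsub>G\<^esub> y \<otimes>\<^bsub>G\<^esub> x))))"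
    proof (rule R.finsum_cong'[OF refl])
      fix z assume z: "z \<in> carrier G"
      have "inv\<^bsub>G\<^esub> y \<otimes>\<^bsub>G\<^esub> (y \<otimes>\<^bsub>G\<^esub> z) = z"
        "inv\<^bsub>G\<^esub> (y \<otimes>\<^bsub>G\<^esub> z) \<otimes>\<^bsub>G\<^esub> x = inv\<^bsub>G\<^esub> z \<otimes>\<^bsub>G\<^esub> (inv\<^bsub>G\<^esub> y \<otimes>\<^bsub>G\<^esub> x)"
        using x y z by (simp_all add: G.m_assoc[symmetric] G.inv_mult_group)
      then show "?t (y \<otimes>\<^bsub>G\<^esub> z) =
          f y \<otimes>\<^bsub>R\<^esub> (g z \<otimes>\<^bsub>R\<^esub> h (inv\<^bsub>G\<^esub> z \<otimes>\<^bsub>G\<^esub> (inv\<^bsub>G\<^esub> y \<otimes>\<^bsub>G\<^esub> x)))"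
        using x y z closed by (simp add: R.m_assoc)
    qed (use x y closed in auto)
    also have "\<dots> = f y \<otimes>\<^bsub>R\<^esub>
        (\<Oplus>\<^bsub>R\<^esub>z\<in>carrier G. g z \<otimes>\<^bsub>R\<^esub> h (inv\<^bsub>G\<^esub> z \<otimes>\<^bsub>G\<^esub> (inv\<^bsub>G\<^esub> y \<otimes>\<^bsub>G\<^esub> x)))"
      using x y closed fin by (intro R.finsum_rdistr[symmetric]) auto
    finally show "(\<Oplus>\<^bsub>R\<^esub>z\<in>carrier G. ?t z) = f y \<otimes>\<^bsub>R\<^esub>
        (\<Oplus>\<^bsub>R\<^esub>z\<in>carrier G. g z \<otimes>\<^bsub>R\<^esub> h (inv\<^bsub>G\<^esub> z \<otimes>\<^bsub>G\<^esub> (inv\<^bsub>G\<^esub> y \<otimes>\<^bsub>G\<^esub> x)))" .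
  qed (use x closed in \<open>auto intro!: R.finsum_closed\<close>)
  also have "\<dots> = (f \<otimes>\<^bsub>group_algebra R G\<^esub> (g \<otimes>\<^bsub>group_algebra R G\<^esub> h)) x"
    unfolding group_algebra_mult using x closed
    by (auto intro!: R.finsum_cong' R.finsum_closed)
  finally show "((f \<otimes>\<^bsub>group_algebra R G\<^esub> g) \<otimes>\<^bsub>group_algebra R G\<^esub> h) x = (f \<otimes>\<^bsub>group_algebra R G\<^esub> (g \<otimes>\<^bsub>group_algebra R G\<^esub> h)) x" .
qed (use assms in \<open>auto intro!: group_algebra_mult_closed\<close>)

lemma ring_group_algebra: "ring (group_algebra R G)"
proof (rule ringI)
  show "abelian_group (group_algebra R G)"
  proof (rule abelian_groupI)
    fix f assume f: "f \<in> carrier (group_algebra R G)"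
    show "\<exists>g\<in>carrier (group_algebra R G). g \<oplus>\<^bsub>group_algebra R G\<^esub> f = \<zero>\<^bsub>group_algebra R G\<^esub>"
      using group_algebra_app_closed[OF f]
      by (intro bexI[of _ "\<lambda>x\<in>carrier G. \<ominus>\<^bsub>R\<^esub> f x"])
        (auto simp: group_algebra_def R.l_neg intro!: restrict_ext)
  qed (auto simp: group_algebra_def Pi_iff PiE_iff R.a_ac extensional_def fun_eq_iff intro!: restrict_ext)
  show "monoid (group_algebra R G)"
  proof (rule monoidI)
    fix f assume f: "f \<in> carrier (group_algebra R G)"
    show "f \<otimes>\<^bsub>group_algebra R G\<^esub> \<one>\<^bsub>group_algebra R G\<^esub> = f"
      unfolding group_algebra_one mult_ga_basis[OF f G.one_closed]
      using f by (auto simp: group_algebra_def PiE_iff extensional_def fun_eq_iff)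
  qed (auto simp: group_algebra_mult_closed group_algebra_one[symmetric] one_mult_group_algebra
      group_algebra_mult_assoc, simp add: group_algebra_one ga_basis_closed)
next
  fix f g h assume fgh: "f \<in> carrier (group_algebra R G)" "g \<in> carrier (group_algebra R G)" "h \<in> carrier (group_algebra R G)"
  have add: "(u \<oplus>\<^bsub>group_algebra R G\<^esub> v) x = u x \<oplus>\<^bsub>R\<^esub> v x" if "x \<in> carrier G" for u v x
    using that by (simp add: group_algebra_def)
  have add': "u \<oplus>\<^bsub>group_algebra R G\<^esub> v = (\<lambda>x\<in>carrier G. u x \<oplus>\<^bsub>R\<^esub> v x)" for u v
    by (simp add: group_algebra_def)
  note closed = fgh[THEN group_algebra_app_closed]
  show "(f \<oplus>\<^bsub>group_algebra R G\<^esub> g) \<otimes>\<^bsub>group_algebra R G\<^esub> h = f \<otimes>\<^bsub>group_algebra R G\<^esub> h \<oplus>\<^bsub>group_algebra R G\<^esub> g \<otimes>\<^bsub>group_algebra R G\<^esub> h"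
    unfolding group_algebra_mult add'[of "restrict _ _"]
  proof (rule restrict_ext)
    fix x assume x: "x \<in> carrier G"
    have "(\<Oplus>\<^bsub>R\<^esub>y\<in>carrier G. (f \<oplus>\<^bsub>group_algebra R G\<^esub> g) y \<otimes>\<^bsub>R\<^esub> h (inv\<^bsub>G\<^esub> y \<otimes>\<^bsub>G\<^esub> x)) =
      (\<Oplus>\<^bsub>R\<^esub>y\<in>carrier G. f y \<otimes>\<^bsub>R\<^esub> h (inv\<^bsub>G\<^esub> y \<otimes>\<^bsub>G\<^esub> x) \<oplus>\<^bsub>R\<^esub> g y \<otimes>\<^bsub>R\<^esub> h (inv\<^bsub>G\<^esub> y \<otimes>\<^bsub>G\<^esub> x))"
      using x closed by (intro R.finsum_cong') (auto simp: add R.l_distr)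
    also have "\<dots> = (\<Oplus>\<^bsub>R\<^esub>y\<in>carrier G. f y \<otimes>\<^bsub>R\<^esub> h (inv\<^bsub>G\<^esub> y \<otimes>\<^bsub>G\<^esub> x)) \<oplus>\<^bsub>R\<^esub>
        (\<Oplus>\<^bsub>R\<^esub>y\<in>carrier G. g y \<otimes>\<^bsub>R\<^esub> h (inv\<^bsub>G\<^esub> y \<otimes>\<^bsub>G\<^esub> x))"
      using x closed by (intro R.finsum_addf) auto
    finally show "(\<Oplus>\<^bsub>R\<^esub>y\<in>carrier G. (f \<oplus>\<^bsub>group_algebra R G\<^esub> g) y \<otimes>\<^bsub>R\<^esub> h (inv\<^bsub>G\<^esub> y \<otimes>\<^bsub>G\<^esub> x)) =
      (\<lambda>x\<in>carrier G. \<Oplus>\<^bsub>R\<^esub>y\<in>carrier G. f y \<otimes>\<^bsub>R\<^esub> h (inv\<^bsub>G\<^esub> y \<otimes>\<^bsub>G\<^esub> x)) x \<oplus>\<^bsub>R\<^esub>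
      (\<lambda>x\<in>carrier G. \<Oplus>\<^bsub>R\<^esub>y\<in>carrier G. g y \<otimes>\<^bsub>R\<^esub> h (inv\<^bsub>G\<^esub> y \<otimes>\<^bsub>G\<^esub> x)) x"
      using x by simp
  qed
  show "h \<otimes>\<^bsub>group_algebra R G\<^esub> (f \<oplus>\<^bsub>group_algebra R G\<^esub> g) = h \<otimes>\<^bsub>group_algebra R G\<^esub> f \<oplus>\<^bsub>group_algebra R G\<^esub> h \<otimes>\<^bsub>group_algebra R G\<^esub> g"
    unfolding group_algebra_mult add'[of "restrict _ _"]
  proof (rule restrict_ext)
    fix x assume x: "x \<in> carrier G"
    have "(\<Oplus>\<^bsub>R\<^esub>y\<in>carrier G. h y \<otimes>\<^bsub>R\<^esub> (f \<oplus>\<^bsub>group_algebra R G\<^esub> g) (inv\<^bsub>G\<^esub> y \<otimes>\<^bsub>G\<^esub> x)) =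
      (\<Oplus>\<^bsub>R\<^esub>y\<in>carrier G. h y \<otimes>\<^bsub>R\<^esub> f (inv\<^bsub>G\<^esub> y \<otimes>\<^bsub>G\<^esub> x) \<oplus>\<^bsub>R\<^esub> h y \<otimes>\<^bsub>R\<^esub> g (inv\<^bsub>G\<^esub> y \<otimes>\<^bsub>G\<^esub> x))"
      using x closed by (intro R.finsum_cong') (auto simp: add R.r_distr)
    also have "\<dots> = (\<Oplus>\<^bsub>R\<^esub>y\<in>carrier G. h y \<otimes>\<^bsub>R\<^esub> f (inv\<^bsub>G\<^esub> y \<otimes>\<^bsub>G\<^esub> x)) \<oplus>\<^bsub>R\<^esub>
        (\<Oplus>\<^bsub>R\<^esub>y\<in>carrier G. h y \<otimes>\<^bsub>R\<^esub> g (inv\<^bsub>G\<^esub> y \<otimes>\<^bsub>G\<^esub> x))"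
      using x closed by (intro R.finsum_addf) auto
    finally show "(\<Oplus>\<^bsub>R\<^esub>y\<in>carrier G. h y \<otimes>\<^bsub>R\<^esub> (f \<oplus>\<^bsub>group_algebra R G\<^esub> g) (inv\<^bsub>G\<^esub> y \<otimes>\<^bsub>G\<^esub> x)) =
      (\<lambda>x\<in>carrier G. \<Oplus>\<^bsub>R\<^esub>y\<in>carrier G. h y \<otimes>\<^bsub>R\<^esub> f (inv\<^bsub>G\<^esub> y \<otimes>\<^bsub>G\<^esub> x)) x \<oplus>\<^bsub>R\<^esub>
      (\<lambda>x\<in>carrier G. \<Oplus>\<^bsub>R\<^esub>y\<in>carrier G. h y \<otimes>\<^bsub>R\<^esub> g (inv\<^bsub>G\<^esub> y \<otimes>\<^bsub>G\<^esub> x)) x"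
      using x by simp
  qed
qed

interpretation A: ring "group_algebra R G" by (rule ring_group_algebra)

section \<open>Evaluation of coefficients and integral elements\<close>

text \<open>Differences and integer multiples are built from the additive group alone, so this
  homomorphism computes them coefficientwise.\<close>

lemma group_hom_group_algebra_app:
  assumes "x \<in> carrier G"
  shows "group_hom (add_monoid (group_algebra R G)) (add_monoid R) (\<lambda>f. f x)"
proof (intro group_hom.intro group_hom_axioms.intro homI)
  fix f g assume "f \<in> carrier (add_monoid (group_algebra R G))" "g \<in> carrier (add_monoid (group_algebra R G))"
  then show "f x \<in> carrier (add_monoid R)"
    "(f \<otimes>\<^bsub>add_monoid (group_algebra R G)\<^esub> g) x = f x \<otimes>\<^bsub>add_monoid R\<^esub> g x"
    using assms by (auto simp: group_algebra_def)
qed (use A.a_group R.a_group in auto)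

lemma group_algebra_minus_app:
  assumes "f \<in> carrier (group_algebra R G)" "g \<in> carrier (group_algebra R G)" "x \<in> carrier G"
  shows "(f \<ominus>\<^bsub>group_algebra R G\<^esub> g) x = f x \<ominus>\<^bsub>R\<^esub> g x"
proof -
  interpret group_hom "add_monoid (group_algebra R G)" "add_monoid R" "\<lambda>f. f x"
    by (rule group_hom_group_algebra_app[OF assms(3)])
  show ?thesis
    using assms hom_mult[of f "\<ominus>\<^bsub>group_algebra R G\<^esub> g"] hom_inv[of g] A.a_inv_closed[of g]
    by (simp add: a_minus_def a_inv_def)
qed

lemma group_algebra_int_app:
  assumes "f \<in> carrier (group_algebra R G)" "x \<in> carrier G"
  shows "([(k::int)] \<cdot>\<^bsub>group_algebra R G\<^esub> f) x = [k] \<cdot>\<^bsub>R\<^esub> f x"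
proof -
  interpret group_hom "add_monoid (group_algebra R G)" "add_monoid R" "\<lambda>f. f x"
    by (rule group_hom_group_algebra_app[OF assms(2)])
  show ?thesis
    using assms hom_int_pow[of f k] by (simp add: add_pow_def)
qed

text \<open>Base change from integer coefficients along the canonical map from the integers to
  \<open>R\<close>, which may fail to be injective. It transfers identities proved over the integers
  to every \<open>R\<close>.\<close>

definition ga_of_int :: "('g \<Rightarrow> int) \<Rightarrow> ('g \<Rightarrow> 'k)" where
  "ga_of_int f = (\<lambda>x\<in>carrier G. [f x] \<cdot>\<^bsub>R\<^esub> \<one>\<^bsub>R\<^esub>)"

lemma ga_of_int_closed: "ga_of_int f \<in> carrier (group_algebra R G)"
  by (auto simp: ga_of_int_def group_algebra_def)

lemma ga_of_int_mult_basis: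
  "w \<in> carrier G \<Longrightarrow>
    ga_of_int f \<otimes>\<^bsub>group_algebra R G\<^esub> ga_basis R G w = ga_of_int (\<lambda>x. f (x \<otimes>\<^bsub>G\<^esub> inv\<^bsub>G\<^esub> w))"
  by (subst mult_ga_basis) (auto simp: ga_of_int_closed, auto simp: ga_of_int_def)

lemma int_zero_pow: "[(0::int)] \<cdot>\<^bsub>R\<^esub> a = \<zero>\<^bsub>R\<^esub>"
  by (simp add: add_pow_def)

lemma ga_of_int_zero: "ga_of_int (\<lambda>x. 0) = \<zero>\<^bsub>group_algebra R G\<^esub>"
  by (simp add: ga_of_int_def int_zero_pow) (simp add: group_algebra_def)

lemma ga_of_int_sum:
  "finite V \<Longrightarrow> (\<Oplus>\<^bsub>group_algebra R G\<^esub>v\<in>V. ga_of_int (f v)) = ga_of_int (\<lambda>x. \<Sum>v\<in>V. f v x)"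
proof (induction V rule: finite_induct)
  case empty
  then show ?case by (simp add: ga_of_int_zero)
next
  case (insert v V)
  have "ga_of_int (f v) \<oplus>\<^bsub>group_algebra R G\<^esub> ga_of_int (\<lambda>x. \<Sum>v\<in>V. f v x) =
      ga_of_int (\<lambda>x. f v x + (\<Sum>v\<in>V. f v x))"
    by (auto simp: ga_of_int_def group_algebra_def R.add.int_pow_mult intro!: restrict_ext)
  then show ?case
    using insert by (simp add: ga_of_int_closed A.finsum_insert)
qed

lemma ga_of_int_minus:
  "ga_of_int f \<ominus>\<^bsub>group_algebra R G\<^esub> [k] \<cdot>\<^bsub>group_algebra R G\<^esub> ga_of_int g = ga_of_int (\<lambda>x. f x - k * g x)"
proof (rule group_algebra_eqI)
  fix x assume x: "x \<in> carrier G"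
  have "[(f x - k * g x)] \<cdot>\<^bsub>R\<^esub> \<one>\<^bsub>R\<^esub> =
      [f x] \<cdot>\<^bsub>R\<^esub> \<one>\<^bsub>R\<^esub> \<ominus>\<^bsub>R\<^esub> [k] \<cdot>\<^bsub>R\<^esub> ([g x] \<cdot>\<^bsub>R\<^esub> \<one>\<^bsub>R\<^esub>)"
    by (simp add: R.add.int_pow_diff R.add.int_pow_pow R.minus_eq mult.commute)
  then show "(ga_of_int f \<ominus>\<^bsub>group_algebra R G\<^esub> [k] \<cdot>\<^bsub>group_algebra R G\<^esub> ga_of_int g) x = ga_of_int (\<lambda>x. f x - k * g x) x"
    using x by (simp add: group_algebra_minus_app group_algebra_int_app ga_of_int_closed)
      (simp add: ga_of_int_def)
qed (simp_all add: ga_of_int_closed)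

lemma ga_of_int_basis: "ga_of_int (\<lambda>x. if x = w then 1 else 0) = ga_basis R G w"
  by (auto simp: ga_of_int_def ga_basis_def int_zero_pow intro!: restrict_ext)

end

section \<open>Transfer to the group algebra of the symmetric group\<close>

lemma carrier_sym_group: "carrier (sym_group n) = {w. w permutes {1..n}}"
  by (auto simp: sym_group_carrier)

lemma finite_sym_group: "finite (carrier (sym_group n))"
  by (simp add: carrier_sym_group finite_permutations)

lemma inv_longest_perm: "inv' (longest_perm n) = longest_perm n"
  by (rule inv_unique_comp) (rule longest_perm_involution)+

context
  fixes R :: "('k, 'm) ring_scheme" and n :: nat
  assumes R: "ring R"
begin

interpretation R: ring R by (rule R)

lemmas sym_algebra_facts = R sym_group_is_group[of n] finite_sym_group

interpretation A: ring "sym_algebra R n"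
  by (rule ring_group_algebra[OF sym_algebra_facts])

lemmas of_int_closed = ga_of_int_closed[OF sym_algebra_facts]

lemma of_int_mult_basis:
  assumes "w permutes {1..n}"
  shows "ga_of_int R (sym_group n) f \<otimes>\<^bsub>sym_algebra R n\<^esub> ga_basis R (sym_group n) w = ga_of_int R (sym_group n) (\<lambda>x. f (x \<circ> inv' w))"
  using ga_of_int_mult_basis[OF sym_algebra_facts, of w f] assms
  by (simp add: sym_group_mult sym_group_carrier)

lemma w0_elem_closed: "w0_elem R n \<in> carrier (sym_algebra R n)"
  unfolding w0_elem_def by (rule ga_basis_closed[OF sym_algebra_facts])

lemma of_int_mult_w0: "ga_of_int R (sym_group n) f \<otimes>\<^bsub>sym_algebra R n\<^esub> w0_elem R n = ga_of_int R (sym_group n) (rmul_w0 n f)"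
  using of_int_mult_basis[OF longest_perm_permutes, of f]
  by (simp add: w0_elem_def inv_longest_perm rmul_w0_def[abs_def])

lemma w0_elem_square: "w0_elem R n \<otimes>\<^bsub>sym_algebra R n\<^esub> w0_elem R n = \<one>\<^bsub>sym_algebra R n\<^esub>"
proof -
  have "w \<circ> longest_perm n = longest_perm n \<longleftrightarrow> w = id" for w
  proof
    assume "w \<circ> longest_perm n = longest_perm n"
    then have "w \<circ> (longest_perm n \<circ> longest_perm n) = longest_perm n \<circ> longest_perm n"
      by (simp add: o_assoc)
    then show "w = id" by (simp add: longest_perm_involution)
  qed simp
  then show ?thesis
    using of_int_mult_w0[of "\<lambda>x. if x = longest_perm n then 1 else 0"]
    by (simp add: ga_of_int_basis[OF sym_algebra_facts] w0_elem_def rmul_w0_def[abs_def] group_algebra_one[OF sym_algebra_facts]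
        sym_group_one)
qed

lemma B_elem_eq: "B_elem R n \<alpha> = (\<Oplus>\<^bsub>sym_algebra R n\<^esub>w\<in>shuffles_of n \<alpha>. ga_basis R (sym_group n) w)"
  by (simp add: B_elem_def shuffles_of_def sym_group_carrier)

lemma B_elem_closed: "B_elem R n \<alpha> \<in> carrier (sym_algebra R n)"
  unfolding B_elem_eq using ga_basis_closed[OF sym_algebra_facts] by (intro A.finsum_closed) auto

lemma of_int_mult_B: "ga_of_int R (sym_group n) f \<otimes>\<^bsub>sym_algebra R n\<^esub> B_elem R n \<alpha> = ga_of_int R (sym_group n) (rmul_B n \<alpha> f)"
proof -
  have fin: "finite (shuffles_of n \<alpha>)"
    using finite_permutations[of "{1..n}"] by (simp add: shuffles_of_def)
  have "ga_of_int R (sym_group n) f \<otimes>\<^bsub>sym_algebra R n\<^esub> B_elem R n \<alpha> =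
      (\<Oplus>\<^bsub>sym_algebra R n\<^esub>v\<in>shuffles_of n \<alpha>. ga_of_int R (sym_group n) f \<otimes>\<^bsub>sym_algebra R n\<^esub> ga_basis R (sym_group n) v)"
    unfolding B_elem_eq using fin of_int_closed ga_basis_closed[OF sym_algebra_facts]
    by (intro A.finsum_rdistr) auto
  also have "\<dots> = (\<Oplus>\<^bsub>sym_algebra R n\<^esub>v\<in>shuffles_of n \<alpha>. ga_of_int R (sym_group n) (\<lambda>x. f (x \<circ> inv' v)))"
    using of_int_closed by (intro A.finsum_cong') (auto simp: of_int_mult_basis shuffles_of_def)
  also have "\<dots> = ga_of_int R (sym_group n) (rmul_B n \<alpha> f)"
    unfolding ga_of_int_sum[OF sym_algebra_facts fin] by (simp add: rmul_B_def[abs_def])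
  finally show ?thesis .
qed

lemma of_int_mult_shift:
  "ga_of_int R (sym_group n) f \<otimes>\<^bsub>sym_algebra R n\<^esub> (w0_elem R n \<otimes>\<^bsub>sym_algebra R n\<^esub> B_elem R n \<alpha> \<ominus>\<^bsub>sym_algebra R n\<^esub> [k] \<cdot>\<^bsub>sym_algebra R n\<^esub> \<one>\<^bsub>sym_algebra R n\<^esub>) =
    ga_of_int R (sym_group n) (rmul_shift n \<alpha> k f)"
proof -
  let ?x = "w0_elem R n \<otimes>\<^bsub>sym_algebra R n\<^esub> B_elem R n \<alpha>"
  have "ga_of_int R (sym_group n) f \<otimes>\<^bsub>sym_algebra R n\<^esub> (?x \<ominus>\<^bsub>sym_algebra R n\<^esub> [k] \<cdot>\<^bsub>sym_algebra R n\<^esub> \<one>\<^bsub>sym_algebra R n\<^esub>) =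
      ga_of_int R (sym_group n) f \<otimes>\<^bsub>sym_algebra R n\<^esub> ?x \<ominus>\<^bsub>sym_algebra R n\<^esub> [k] \<cdot>\<^bsub>sym_algebra R n\<^esub> ga_of_int R (sym_group n) f"
    by (simp add: A.minus_eq A.r_distr A.r_minus A.add_pow_rdistr_int of_int_closed
        w0_elem_closed B_elem_closed)
  also have "ga_of_int R (sym_group n) f \<otimes>\<^bsub>sym_algebra R n\<^esub> ?x = ga_of_int R (sym_group n) (rmul_w0B n \<alpha> f)"
    by (simp add: A.m_assoc[symmetric] of_int_closed w0_elem_closed B_elem_closed of_int_mult_w0
        of_int_mult_B rmul_w0B_def)
  finally show ?thesis
    by (simp add: ga_of_int_minus[OF sym_algebra_facts] rmul_shift_def[abs_def])
qed

text \<open>Multiplication from the right applies the leftmost factor first, so the product nested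
  by \<open>foldr\<close> corresponds to \<open>fold\<close> of the operators.\<close>

lemma of_int_mult_foldr_shift:
  "ga_of_int R (sym_group n) f \<otimes>\<^bsub>sym_algebra R n\<^esub> foldr (\<lambda>k z.
      (w0_elem R n \<otimes>\<^bsub>sym_algebra R n\<^esub> B_elem R n \<alpha> \<ominus>\<^bsub>sym_algebra R n\<^esub> [k] \<cdot>\<^bsub>sym_algebra R n\<^esub> \<one>\<^bsub>sym_algebra R n\<^esub>) \<otimes>\<^bsub>sym_algebra R n\<^esub> z)
      ks \<one>\<^bsub>sym_algebra R n\<^esub> =
    ga_of_int R (sym_group n) (fold (rmul_shift n \<alpha>) ks f)"
proof (induction ks arbitrary: f)
  case Nil
  then show ?case by (simp add: of_int_closed)
next
  case (Cons k ks)
  have x: "w0_elem R n \<otimes>\<^bsub>sym_algebra R n\<^esub> B_elem R n \<alpha> \<in> carrier (sym_algebra R n)"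
    by (simp add: w0_elem_closed B_elem_closed)
  show ?case
    using x A.foldr_shifts_closed[OF x, of ks]
    by (simp add: A.m_assoc[symmetric] of_int_closed of_int_mult_shift Cons.IH)
qed

text \<open>The product is its own value on the unit, which is the integral element with coefficient
  1 at the identity; the operators send this element to zero.\<close>

lemma foldr_shifts_eq_zero:
  assumes "\<And>f w. w permutes {1..n} \<Longrightarrow> fold (rmul_shift n \<alpha>) ks f w = 0"
  shows "foldr (\<lambda>k z.
      (w0_elem R n \<otimes>\<^bsub>sym_algebra R n\<^esub> B_elem R n \<alpha> \<ominus>\<^bsub>sym_algebra R n\<^esub> [k] \<cdot>\<^bsub>sym_algebra R n\<^esub> \<one>\<^bsub>sym_algebra R n\<^esub>) \<otimes>\<^bsub>sym_algebra R n\<^esub> z)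
      ks \<one>\<^bsub>sym_algebra R n\<^esub> =
    \<zero>\<^bsub>sym_algebra R n\<^esub>" (is "?P = _")
proof -
  let ?\<delta> = "\<lambda>x. if x = id then 1 else 0 :: int"
  have "?P \<in> carrier (sym_algebra R n)"
    by (intro A.foldr_shifts_closed) (simp add: w0_elem_closed B_elem_closed)
  then have "?P = ga_of_int R (sym_group n) ?\<delta> \<otimes>\<^bsub>sym_algebra R n\<^esub> ?P"
    by (simp add: ga_of_int_basis[OF sym_algebra_facts] group_algebra_one[OF sym_algebra_facts, symmetric]
        sym_group_one[of n, symmetric])
  also have "\<dots> = ga_of_int R (sym_group n) (fold (rmul_shift n \<alpha>) ks ?\<delta>)"
    by (rule of_int_mult_foldr_shift)
  also have "\<dots> = ga_of_int R (sym_group n) (\<lambda>x. 0)"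
    using assms unfolding ga_of_int_def[OF sym_algebra_facts]
    by (intro restrict_ext) (simp add: carrier_sym_group)
  finally show ?thesis by (simp add: ga_of_int_zero[OF sym_algebra_facts])
qed

end

theorem theorem7p2:
  fixes R :: "('k, 'm) ring_scheme" and n :: nat and \<alpha> :: "nat list"
  assumes "cring R"
    and "is_composition n \<alpha>"
  defines "A \<equiv> sym_algebra R n"
  shows "(\<Otimes>\<^bsub>A\<^esub>k\<in>signed_n_count n \<alpha> ` set_compositions n.
            (w0_elem R n \<otimes>\<^bsub>A\<^esub> B_elem R n \<alpha>) \<ominus>\<^bsub>A\<^esub> [k] \<cdot>\<^bsub>A\<^esub> \<one>\<^bsub>A\<^esub>) = \<zero>\<^bsub>A\<^esub> \<and>
         (\<Otimes>\<^bsub>A\<^esub>k\<in>signed_n_count n \<alpha> ` set_compositions n.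
            (B_elem R n \<alpha> \<otimes>\<^bsub>A\<^esub> w0_elem R n) \<ominus>\<^bsub>A\<^esub> [k] \<cdot>\<^bsub>A\<^esub> \<one>\<^bsub>A\<^esub>) = \<zero>\<^bsub>A\<^esub>"
proof -
  interpret cring R by fact
  have R: "ring R" by (rule ring_axioms)
  interpret A: ring A
    unfolding A_def by (rule ring_group_algebra[OF R sym_group_is_group finite_sym_group])
  obtain ks where ks: "distinct ks" "set ks = signed_n_count n \<alpha> ` set_comps {1..n}"
    and 0: "\<And>f w. w permutes {1..n} \<Longrightarrow> fold (rmul_shift n \<alpha>) ks f w = 0"
    using fold_rmul_shift_eq_0[OF assms(2)] by blast
  have w: "w0_elem R n \<in> carrier A" "w0_elem R n \<otimes>\<^bsub>A\<^esub> w0_elem R n = \<one>\<^bsub>A\<^esub>"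
    and B: "B_elem R n \<alpha> \<in> carrier A"
    unfolding A_def by (rule w0_elem_closed[OF R] w0_elem_square[OF R] B_elem_closed[OF R])+
  have left: "foldr (\<lambda>k z.
      (w0_elem R n \<otimes>\<^bsub>A\<^esub> B_elem R n \<alpha> \<ominus>\<^bsub>A\<^esub> [k] \<cdot>\<^bsub>A\<^esub> \<one>\<^bsub>A\<^esub>) \<otimes>\<^bsub>A\<^esub> z)
      ks \<one>\<^bsub>A\<^esub> = \<zero>\<^bsub>A\<^esub>"
    unfolding A_def by (rule foldr_shifts_eq_zero[OF R 0])
  \<comment> \<open>This product is the conjugate of the previous one by w_0.\<close>
  have right: "foldr (\<lambda>k z.
      (B_elem R n \<alpha> \<otimes>\<^bsub>A\<^esub> w0_elem R n \<ominus>\<^bsub>A\<^esub> [k] \<cdot>\<^bsub>A\<^esub> \<one>\<^bsub>A\<^esub>) \<otimes>\<^bsub>A\<^esub> z)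
      ks \<one>\<^bsub>A\<^esub> = \<zero>\<^bsub>A\<^esub>"
    using w B by (simp add: A.foldr_shifts_conj left)
  show ?thesis
    \<comment> \<open>All factors are shifts of one element by integers and commute, so the product
      over the set may be taken in the order of \<open>ks\<close>.\<close>
    unfolding set_compositions_eq ks(2)[symmetric]
    using w B ks(1) left right by (simp add: A.finprod_shifts)
qed

end
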